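(* Let $R$ be a graded commutative ring. If $R$ is self-injective then it satisfies the double annihilator condition. Conversely, if $R$ is Noetherian and satisfies the double annihilator condition, then it is self-injective.
   Context: Rings are $\mathbb{Z}$-graded, unital and commutative in the graded sense: $ba=(-1)^{|a||b|}ab$; modules are graded; ``element'' and ``ideal'' mean homogeneous element and homogeneous ideal. For an ideal $J\le R$ put $\operatorname{ann}_R(J)=\{a\in R\mid aJ=0\}$ and $\operatorname{ann}_R^2(J)=\operatorname{ann}_R(\operatorname{ann}_R(J))$. $R$ satisfies the double annihilator condition if $\operatorname{ann}_R^2(J)=J$ for all finitely generated ideals $J$. $R$ is self-injective if $R$ is an injective object in the category of graded $R$-modules. *)

theory Defs
  imports "HOL-Algebra.Algebra"
begin

section \<open>Gradings\<close>

definition homogeneous_decomposition ::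
    "('b, 'c) ring_scheme \<Rightarrow> (int \<Rightarrow> 'b set) \<Rightarrow> 'b \<Rightarrow> (int \<Rightarrow> 'b) \<Rightarrow> bool" where
  "homogeneous_decomposition A G x c \<longleftrightarrow>
     (\<forall>n. c n \<in> G n) \<and> finite {n. c n \<noteq> \<zero>\<^bsub>A\<^esub>} \<and>
     x = finsum A c {n. c n \<noteq> \<zero>\<^bsub>A\<^esub>}"

text \<open>Only the additive structure of the record is used here: the predicate says that the abelian
  group \<open>A\<close> is the internal direct sum of the subgroups \<open>G n\<close>. It is applied both to rings and to
  modules, since the record of modules extends that of rings.\<close>

definition grading :: "('b, 'c) ring_scheme \<Rightarrow> (int \<Rightarrow> 'b set) \<Rightarrow> bool" where
  "grading A G \<longleftrightarrow>
     (\<forall>n. additive_subgroup (G n) A) \<and>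
     (\<forall>x\<in>carrier A. \<exists>!c. homogeneous_decomposition A G x c)"

locale graded_ring = ring R for R (structure) +
  fixes G :: "int \<Rightarrow> 'a set"
  assumes grading: "grading R G"
    and one_degree: "\<one> \<in> G 0"
    and mult_degree: "\<lbrakk>a \<in> G m; b \<in> G n\<rbrakk> \<Longrightarrow> a \<otimes> b \<in> G (m + n)"

locale graded_commutative_ring = graded_ring +
  assumes graded_commute:
    "\<lbrakk>a \<in> G m; b \<in> G n\<rbrakk> \<Longrightarrow> b \<otimes> a = (if even (m * n) then a \<otimes> b else \<ominus> (a \<otimes> b))"

section \<open>Graded modules\<close>

text \<open>The library's locale \<open>module\<close> requires a commutative ring, which a graded commutative ring is
  not; hence left modules over an arbitrary ring. As in the library, the multiplicative fields of
  the record \<open>M\<close> are irrelevant. Left and right graded modules over a graded commutative ring are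
  the same thing via \<open>x r = (-1)\<^bsup>|r||x|\<^esup> r x\<close>.\<close>

locale left_module = R?: ring R + M?: abelian_group M
    for R :: "('a, 'c) ring_scheme" (structure)
    and M :: "('a, 'm, 'd) module_scheme" (structure) +
  assumes smult_closed: "\<lbrakk>a \<in> carrier R; x \<in> carrier M\<rbrakk> \<Longrightarrow> a \<odot>\<^bsub>M\<^esub> x \<in> carrier M"
    and smult_l_distr: "\<lbrakk>a \<in> carrier R; b \<in> carrier R; x \<in> carrier M\<rbrakk>
      \<Longrightarrow> (a \<oplus>\<^bsub>R\<^esub> b) \<odot>\<^bsub>M\<^esub> x = a \<odot>\<^bsub>M\<^esub> x \<oplus>\<^bsub>M\<^esub> b \<odot>\<^bsub>M\<^esub> x"
    and smult_r_distr: "\<lbrakk>a \<in> carrier R; x \<in> carrier M; y \<in> carrier M\<rbrakk>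
      \<Longrightarrow> a \<odot>\<^bsub>M\<^esub> (x \<oplus>\<^bsub>M\<^esub> y) = a \<odot>\<^bsub>M\<^esub> x \<oplus>\<^bsub>M\<^esub> a \<odot>\<^bsub>M\<^esub> y"
    and smult_assoc: "\<lbrakk>a \<in> carrier R; b \<in> carrier R; x \<in> carrier M\<rbrakk>
      \<Longrightarrow> (a \<otimes>\<^bsub>R\<^esub> b) \<odot>\<^bsub>M\<^esub> x = a \<odot>\<^bsub>M\<^esub> (b \<odot>\<^bsub>M\<^esub> x)"
    and smult_one: "x \<in> carrier M \<Longrightarrow> \<one>\<^bsub>R\<^esub> \<odot>\<^bsub>M\<^esub> x = x"

locale graded_module = graded_ring R G + left_module R M
    for R :: "('a, 'c) ring_scheme" (structure) and G
    and M :: "('a, 'm, 'd) module_scheme" (structure) +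
  fixes H :: "int \<Rightarrow> 'm set"
  assumes module_grading: "grading M H"
    and smult_degree: "\<lbrakk>a \<in> G m; x \<in> H n\<rbrakk> \<Longrightarrow> a \<odot>\<^bsub>M\<^esub> x \<in> H (m + n)"

definition graded_module_hom ::
    "('a, 'c) ring_scheme \<Rightarrow> ('a, 'm, 'd) module_scheme \<Rightarrow> (int \<Rightarrow> 'm set) \<Rightarrow>
     ('a, 'n, 'e) module_scheme \<Rightarrow> (int \<Rightarrow> 'n set) \<Rightarrow> ('m \<Rightarrow> 'n) \<Rightarrow> bool" where
  "graded_module_hom R M H N K f \<longleftrightarrow>
     f \<in> hom (add_monoid M) (add_monoid N) \<and>
     (\<forall>a\<in>carrier R. \<forall>x\<in>carrier M. f (a \<odot>\<^bsub>M\<^esub> x) = a \<odot>\<^bsub>N\<^esub> f x) \<and>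
     (\<forall>n. f ` H n \<subseteq> K n)"

section \<open>Injectivity\<close>

text \<open>HOL cannot quantify over types inside a formula, so the universe in which the test modules
  live is an explicit type argument: \<open>graded_injective TYPE('m) R G Q K\<close> says that \<open>Q\<close> has the
  extension property for all monomorphisms of graded modules whose carriers are sets of elements of
  type \<open>'m\<close>. Injectivity in the usual sense is the conjunction of these over all types \<open>'m\<close>:
  a result concluding injectivity should leave \<open>'m\<close> arbitrary, and one assuming it for a single
  \<open>'m\<close> assumes less than injectivity in the usual sense.\<close>

definition graded_injective ::
    "'m itself \<Rightarrow> ('a, 'c) ring_scheme \<Rightarrow> (int \<Rightarrow> 'a set) \<Rightarrow>
     ('a, 'q, 'e) module_scheme \<Rightarrow> (int \<Rightarrow> 'q set) \<Rightarrow> bool" where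
  "graded_injective (_ :: 'm itself) R G Q K \<longleftrightarrow>
     graded_module R G Q K \<and>
     (\<forall>(M :: ('a, 'm) module) H (N :: ('a, 'm) module) L i f.
        graded_module R G M H \<longrightarrow> graded_module R G N L \<longrightarrow>
        graded_module_hom R M H N L i \<longrightarrow> inj_on i (carrier M) \<longrightarrow>
        graded_module_hom R M H Q K f \<longrightarrow>
        (\<exists>g. graded_module_hom R N L Q K g \<and> (\<forall>x\<in>carrier M. g (i x) = f x)))"

definition regular_module :: "('a, 'c) ring_scheme \<Rightarrow> ('a, 'a) module" where
  "regular_module R =
     \<lparr>carrier = carrier R, monoid.mult = monoid.mult R, one = monoid.one R,
      ring.zero = ring.zero R, add = ring.add R, smult = monoid.mult R\<rparr>"

definition graded_self_injective ::
    "'m itself \<Rightarrow> ('a, 'c) ring_scheme \<Rightarrow> (int \<Rightarrow> 'a set) \<Rightarrow> bool" where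
  "graded_self_injective u R G \<longleftrightarrow> graded_injective u R G (regular_module R) G"

section \<open>Homogeneous ideals and annihilators\<close>

definition homogeneous_ideal :: "('a, 'c) ring_scheme \<Rightarrow> (int \<Rightarrow> 'a set) \<Rightarrow> 'a set \<Rightarrow> bool" where
  "homogeneous_ideal R G J \<longleftrightarrow>
     ideal J R \<and> (\<forall>x\<in>J. \<forall>c. homogeneous_decomposition R G x c \<longrightarrow> (\<forall>n. c n \<in> J))"

definition finitely_generated_ideal ::
    "('a, 'c) ring_scheme \<Rightarrow> (int \<Rightarrow> 'a set) \<Rightarrow> 'a set \<Rightarrow> bool" where
  "finitely_generated_ideal R G J \<longleftrightarrow>
     homogeneous_ideal R G J \<and> (\<exists>S \<subseteq> (\<Union>n. G n). finite S \<and> J = Idl\<^bsub>R\<^esub> S)"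

definition graded_noetherian :: "('a, 'c) ring_scheme \<Rightarrow> (int \<Rightarrow> 'a set) \<Rightarrow> bool" where
  "graded_noetherian R G \<longleftrightarrow>
     (\<forall>J. homogeneous_ideal R G J \<longrightarrow> finitely_generated_ideal R G J)"

definition annihilator :: "('a, 'c) ring_scheme \<Rightarrow> 'a set \<Rightarrow> 'a set" where
  "annihilator R J = {a \<in> carrier R. \<forall>x\<in>J. a \<otimes>\<^bsub>R\<^esub> x = \<zero>\<^bsub>R\<^esub>}"

definition double_annihilator_condition ::
    "('a, 'c) ring_scheme \<Rightarrow> (int \<Rightarrow> 'a set) \<Rightarrow> bool" where
  "double_annihilator_condition R G \<longleftrightarrow>
     (\<forall>J. finitely_generated_ideal R G J \<longrightarrow> annihilator R (annihilator R J) = J)"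

end

theory Submission
  imports Defs
begin

text \<open>
  Both implications pass through a graded form of Baer's criterion: every homomorphism of any
  degree \<open>d\<close> from a homogeneous ideal to \<open>R\<close> is right multiplication by an element of degree \<open>d\<close>.

  If \<open>R\<close> is self-injective, the criterion holds: extend the homomorphism from the ideal to \<open>R\<close>,
  both with the grading shifted by \<open>d\<close>, and take the value at \<open>\<one>\<close>. Conversely, the criterion gives
  injectivity against arbitrary monomorphisms: by Zorn's lemma there is a maximal partial extension,
  and the criterion allows one to adjoin any homogeneous element to its domain.

  It remains to compare the criterion with the double annihilator condition. The criterion gives
  \<open>ann\<^sup>2(Rx) = Rx\<close> for homogeneous \<open>x\<close>, because for \<open>y\<close> in \<open>ann\<^sup>2(Rx)\<close> the map \<open>ax \<mapsto> ay\<close> is well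
  defined, hence \<open>y = xr\<close>. It also gives \<open>ann(I \<inter> J) = ann(I) + ann(J)\<close>, because for \<open>a\<close> killing
  \<open>I \<inter> J\<close> the map \<open>i + j \<mapsto> ia\<close> is well defined on \<open>I + J\<close>; if it is multiplication by \<open>r\<close>, then
  \<open>a = (a - r) + r\<close> is the required decomposition. The double annihilator condition then follows by
  induction on the number of generators, as \<open>ann\<^sup>2(I + Rx) = ann(ann(I) \<inter> ann(Rx))\<close> is
  \<open>ann\<^sup>2(I) + ann\<^sup>2(Rx) = I + Rx\<close>.

  In the other direction let \<open>R\<close> be Noetherian with the double annihilator condition, so that every
  homogeneous ideal is its own double annihilator. Then \<open>ann(ann(I) + ann(J)) \<subseteq> I \<inter> J\<close>, and taking
  annihilators shows \<open>ann(I \<inter> J) = ann(I) + ann(J)\<close>. A homomorphism that is multiplication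
  by \<open>r'\<close> on \<open>I\<close> and by \<open>s\<close> on \<open>Rx\<close> has \<open>r' - s\<close> in \<open>ann(I \<inter> Rx)\<close>, so \<open>r' - s = u + v\<close> with \<open>u\<close>
  killing \<open>I\<close> and \<open>v\<close> killing \<open>Rx\<close>, and \<open>r' - u = s + v\<close> works on all of \<open>I + Rx\<close>. Since the domain
  is finitely generated, induction on the generators proves the criterion.

  Annihilators are left annihilators, whereas homomorphisms of left modules are right
  multiplications. The two sides agree for homogeneous ideals, since homogeneous elements commute up
  to sign.
\<close>

section \<open>Homogeneous components\<close>

definition component ::
    "('b, 'c) ring_scheme \<Rightarrow> (int \<Rightarrow> 'b set) \<Rightarrow> 'b \<Rightarrow> int \<Rightarrow> 'b" where
  "component A G x = (THE c. homogeneous_decomposition A G x c)"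

locale graded_abelian_group = abelian_group A for A (structure) +
  fixes G :: "int \<Rightarrow> 'a set"
  assumes is_graded: "grading A G"
begin

lemma degree_subgroup: "additive_subgroup (G n) A"
  using is_graded by (simp add: grading_def)

lemma degree_carrier: "x \<in> G n \<Longrightarrow> x \<in> carrier A"
  using additive_subgroup.a_Hcarr[OF degree_subgroup] .

lemma zero_degree: "\<zero> \<in> G n"
  using additive_subgroup.zero_closed[OF degree_subgroup] .

lemma ex1_decomposition: "x \<in> carrier A \<Longrightarrow> \<exists>!c. homogeneous_decomposition A G x c"
  using is_graded unfolding grading_def by blast

lemma component_decomposition:
  "x \<in> carrier A \<Longrightarrow> homogeneous_decomposition A G x (component A G x)"
  unfolding component_def by (rule theI'[OF ex1_decomposition])

lemma component_degree: "x \<in> carrier A \<Longrightarrow> component A G x n \<in> G n"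
  using component_decomposition by (auto simp: homogeneous_decomposition_def)

lemma component_closed: "x \<in> carrier A \<Longrightarrow> component A G x n \<in> carrier A"
  using component_degree degree_carrier by blast

lemma decomposition_eq_component:
  assumes "homogeneous_decomposition A G x c"
  shows "c = component A G x"
proof -
  have "x \<in> carrier A"
    using assms degree_carrier by (auto simp: homogeneous_decomposition_def intro!: finsum_closed)
  then show ?thesis
    using ex1_decomposition component_decomposition assms by blast
qed

lemma component_eqI:
  assumes "\<And>n. c n \<in> G n" "finite T" "\<And>n. n \<notin> T \<Longrightarrow> c n = \<zero>" "x = finsum A c T"
  shows "component A G x = c"
proof -
  have sub: "{n. c n \<noteq> \<zero>} \<subseteq> T" using assms(3) by blast
  have cl: "c n \<in> carrier A" for n using assms(1) degree_carrier by blast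
  have "finsum A c {n. c n \<noteq> \<zero>} = finsum A c T"
    by (rule add.finprod_mono_neutral_cong_left) (use assms sub cl in auto)
  then have "homogeneous_decomposition A G x c"
    using assms sub finite_subset by (auto simp: homogeneous_decomposition_def)
  then show ?thesis using decomposition_eq_component by simp
qed

lemma component_homogeneous:
  assumes "x \<in> G m"
  shows "component A G x n = (if n = m then x else \<zero>)"
proof -
  have "component A G x = (\<lambda>n. if n = m then x else \<zero>)"
    by (rule component_eqI[where T = "{m}"]) (use assms zero_degree degree_carrier in auto)
  then show ?thesis by simp
qed

lemma component_add:
  assumes "x \<in> carrier A" "y \<in> carrier A"
  shows "component A G (x \<oplus> y) n = component A G x n \<oplus> component A G y n"
proof -
  let ?c = "component A G x" and ?d = "component A G y"
  let ?S = "{n. ?c n \<noteq> \<zero>}" and ?T = "{n. ?d n \<noteq> \<zero>}"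
  have fin: "finite ?S" "finite ?T" and x: "x = finsum A ?c ?S" and y: "y = finsum A ?d ?T"
    using assms component_decomposition by (auto simp: homogeneous_decomposition_def)
  have cl: "?c n \<in> carrier A" "?d n \<in> carrier A" for n
    using assms component_closed by auto
  have "finsum A ?c ?S = finsum A ?c (?S \<union> ?T)" "finsum A ?d ?T = finsum A ?d (?S \<union> ?T)"
    by (rule add.finprod_mono_neutral_cong_left; use fin cl in auto)+
  then have "x \<oplus> y = finsum A (\<lambda>n. ?c n \<oplus> ?d n) (?S \<union> ?T)"
    using x y cl by (subst finsum_addf) auto
  then have "component A G (x \<oplus> y) = (\<lambda>n. ?c n \<oplus> ?d n)"
    using fin cl component_degree assms
    by (intro component_eqI[where T = "?S \<union> ?T"])
      (auto intro: additive_subgroup.a_closed[OF degree_subgroup])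
  then show ?thesis by simp
qed

text \<open>This replaces all computations with the defining finite sums: an additively closed condition
  on \<open>x\<close> need only be checked on homogeneous components.\<close>

lemma mem_if_components_mem:
  assumes "x \<in> carrier A" "\<And>n. component A G x n \<in> S"
    and "\<zero> \<in> S" "\<And>y z. y \<in> S \<Longrightarrow> z \<in> S \<Longrightarrow> y \<oplus> z \<in> S"
  shows "x \<in> S"
proof -
  let ?c = "component A G x"
  have "finite T \<Longrightarrow> finsum A ?c T \<in> S" for T
    by (induction T rule: finite_induct) (use assms component_closed in auto)
  moreover have "finite {n. ?c n \<noteq> \<zero>}" "x = finsum A ?c {n. ?c n \<noteq> \<zero>}"
    using component_decomposition[OF assms(1)] by (auto simp only: homogeneous_decomposition_def)
  ultimately show ?thesis by metis
qed

text \<open>Forming components commutes with every additive map that shifts degrees. Multiplication by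
  a homogeneous element, on either side, and graded homomorphisms are all of this kind.\<close>

lemma component_additive_map:
  assumes "graded_abelian_group B K"
    and closed: "\<And>x. x \<in> carrier A \<Longrightarrow> f x \<in> carrier B"
    and add: "\<And>x y. x \<in> carrier A \<Longrightarrow> y \<in> carrier A \<Longrightarrow> f (x \<oplus> y) = f x \<oplus>\<^bsub>B\<^esub> f y"
    and degree: "\<And>n x. x \<in> G n \<Longrightarrow> f x \<in> K (n + d)"
    and x: "x \<in> carrier A"
  shows "component B K (f x) (n + d) = f (component A G x n)"
proof -
  interpret B: graded_abelian_group B K by fact
  have zero: "f \<zero> = \<zero>\<^bsub>B\<^esub>"
    using add[of \<zero> \<zero>] closed[of \<zero>] by (simp add: B.add.r_cancel_one')
  let ?S = "{y \<in> carrier A. \<forall>n. component B K (f y) (n + d) = f (component A G y n)}"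
  have "x \<in> ?S"
  proof (rule mem_if_components_mem[OF x])
    fix m
    have m: "component A G x m \<in> G m" using x by (rule component_degree)
    show "component A G x m \<in> ?S"
      using component_homogeneous[OF m] B.component_homogeneous[OF degree[OF m]]
        degree_carrier[OF m] zero by auto
  next
    show "\<zero> \<in> ?S"
      using component_homogeneous[OF zero_degree] B.component_homogeneous[OF B.zero_degree] zero
      by auto
  qed (use component_add B.component_add closed add component_closed in auto)
  then show ?thesis by blast
qed

end

sublocale graded_ring \<subseteq> graded_abelian_group R G
  by unfold_locales (rule grading)

sublocale graded_module \<subseteq> N: graded_abelian_group M H
  by unfold_locales (rule module_grading)

context graded_ring
begin

lemma component_lmult:
  assumes "a \<in> G m" "x \<in> carrier R"
  shows "component R G (a \<otimes> x) (n + m) = a \<otimes> component R G x n"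
  by (rule component_additive_map[where f = "\<lambda>x. a \<otimes> x"])
    (use assms degree_carrier[OF assms(1)] mult_degree[OF assms(1)] graded_abelian_group_axioms
      in \<open>auto simp: r_distr add.commute[of _ m]\<close>)

lemma component_rmult:
  assumes "a \<in> G m" "x \<in> carrier R"
  shows "component R G (x \<otimes> a) (n + m) = component R G x n \<otimes> a"
  by (rule component_additive_map[where f = "\<lambda>x. x \<otimes> a"])
    (use assms degree_carrier[OF assms(1)] mult_degree[OF _ assms(1)] graded_abelian_group_axioms
      in \<open>auto simp: l_distr\<close>)

lemma homogeneous_ideal_iff:
  "homogeneous_ideal R G J \<longleftrightarrow> ideal J R \<and> (\<forall>x\<in>J. \<forall>n. component R G x n \<in> J)"
proof (cases "ideal J R")
  case True
  have "(\<forall>c. homogeneous_decomposition R G x c \<longrightarrow> (\<forall>n. c n \<in> J)) \<longleftrightarrow>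
    (\<forall>n. component R G x n \<in> J)" if "x \<in> J" for x
  proof -
    have "x \<in> carrier R" using ideal.Icarr[OF True that] .
    then have "homogeneous_decomposition R G x c \<longleftrightarrow> c = component R G x" for c
      using component_decomposition decomposition_eq_component by (intro iffI) simp_all
    then show ?thesis by simp
  qed
  then show ?thesis
    unfolding homogeneous_ideal_def using True by (intro conj_cong ball_cong) simp_all
qed (simp add: homogeneous_ideal_def)

end

context graded_commutative_ring
begin

text \<open>Two homogeneous elements commute up to sign, so a homogeneous element can be moved past an
  arbitrary one at the price of changing the latter: if \<open>n\<close> is odd, its
  components of odd degree change sign.\<close>

lemma move_homogeneous_left:
  assumes "x \<in> G n" "a \<in> carrier R"
  shows "\<exists>b\<in>carrier R. a \<otimes> x = x \<otimes> b"
proof -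
  have x: "x \<in> carrier R" using assms degree_carrier by blast
  let ?S = "{a \<in> carrier R. \<exists>b\<in>carrier R. a \<otimes> x = x \<otimes> b}"
  have "a \<in> ?S"
  proof (rule mem_if_components_mem[OF assms(2)])
    fix m
    have m: "component R G a m \<in> G m" using assms component_degree by blast
    then have mc: "component R G a m \<in> carrier R" using degree_carrier by blast
    have "component R G a m \<otimes> x =
      x \<otimes> (if even (n * m) then component R G a m else \<ominus> component R G a m)"
      using graded_commute[OF assms(1) m] x mc by (simp add: r_minus)
    then show "component R G a m \<in> ?S"
      using mc by (intro CollectI conjI bexI) (assumption+, simp)
  next
    show "\<zero> \<in> ?S" using x by (auto intro!: bexI[of _ \<zero>])
  next
    fix y z assume "y \<in> ?S" "z \<in> ?S"
    then obtain b c where "b \<in> carrier R" "c \<in> carrier R" "y \<otimes> x = x \<otimes> b" "z \<otimes> x = x \<otimes> c"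
      "y \<in> carrier R" "z \<in> carrier R" by blast
    then show "y \<oplus> z \<in> ?S"
      using x by (auto simp: l_distr intro!: bexI[of _ "b \<oplus> c"] simp: r_distr)
  qed
  then show ?thesis by blast
qed

lemma move_homogeneous_right:
  assumes "x \<in> G n" "a \<in> carrier R"
  shows "\<exists>b\<in>carrier R. x \<otimes> a = b \<otimes> x"
proof -
  have x: "x \<in> carrier R" using assms degree_carrier by blast
  let ?S = "{a \<in> carrier R. \<exists>b\<in>carrier R. x \<otimes> a = b \<otimes> x}"
  have "a \<in> ?S"
  proof (rule mem_if_components_mem[OF assms(2)])
    fix m
    have m: "component R G a m \<in> G m" using assms component_degree by blast
    then have mc: "component R G a m \<in> carrier R" using degree_carrier by blast
    have "x \<otimes> component R G a m =
      (if even (m * n) then component R G a m else \<ominus> component R G a m) \<otimes> x"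
      using graded_commute[OF m assms(1)] x mc by (simp add: l_minus)
    then show "component R G a m \<in> ?S"
      using mc by (intro CollectI conjI bexI) (assumption+, simp)
  next
    show "\<zero> \<in> ?S" using x by (auto intro!: bexI[of _ \<zero>])
  next
    fix y z assume "y \<in> ?S" "z \<in> ?S"
    then obtain b c where "b \<in> carrier R" "c \<in> carrier R" "x \<otimes> y = b \<otimes> x" "x \<otimes> z = c \<otimes> x"
      "y \<in> carrier R" "z \<in> carrier R" by blast
    then show "y \<oplus> z \<in> ?S"
      using x by (auto simp: r_distr intro!: bexI[of _ "b \<oplus> c"] simp: l_distr)
  qed
  then show ?thesis by blast
qed

text \<open>Homogeneous left ideals are two-sided, because a homogeneous element can be moved past any
  scalar; the argument reduces to homogeneous \<open>x\<close> and so needs closure under components.\<close>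

lemma homogeneous_idealI:
  assumes sub: "J \<subseteq> carrier R" and zero: "\<zero> \<in> J"
    and add: "\<And>x y. x \<in> J \<Longrightarrow> y \<in> J \<Longrightarrow> x \<oplus> y \<in> J"
    and lmult: "\<And>a x. a \<in> carrier R \<Longrightarrow> x \<in> J \<Longrightarrow> a \<otimes> x \<in> J"
    and comp: "\<And>x n. x \<in> J \<Longrightarrow> component R G x n \<in> J"
  shows "homogeneous_ideal R G J"
proof -
  have neg: "\<ominus> x \<in> J" if "x \<in> J" for x
    using lmult[OF _ that, of "\<ominus> \<one>"] that sub by (auto simp: l_minus)
  have rmult: "x \<otimes> a \<in> J" if x: "x \<in> J" and a: "a \<in> carrier R" for x a
  proof -
    let ?S = "{x \<in> carrier R. x \<otimes> a \<in> J}"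
    have "x \<in> ?S"
    proof (rule mem_if_components_mem)
      fix n
      obtain b where "b \<in> carrier R" "component R G x n \<otimes> a = b \<otimes> component R G x n"
        using move_homogeneous_right[OF component_degree a] x sub by blast
      then show "component R G x n \<in> ?S"
        using lmult comp x sub by auto
    qed (use x sub zero a add in \<open>auto simp: l_distr\<close>)
    then show ?thesis by blast
  qed
  have "subgroup J (add_monoid R)"
    using sub zero add neg by (auto intro!: add.subgroupI)
  then have "ideal J R"
    using lmult rmult by (intro idealI) (auto intro: local.ring_axioms)
  then show ?thesis using comp by (simp add: homogeneous_ideal_iff)
qed

lemma homogeneous_idealD:
  assumes "homogeneous_ideal R G J"
  shows "ideal J R" "J \<subseteq> carrier R" "\<zero> \<in> J"
    "\<And>x y. x \<in> J \<Longrightarrow> y \<in> J \<Longrightarrow> x \<oplus> y \<in> J"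
    "\<And>x. x \<in> J \<Longrightarrow> \<ominus> x \<in> J"
    "\<And>a x. a \<in> carrier R \<Longrightarrow> x \<in> J \<Longrightarrow> a \<otimes> x \<in> J"
    "\<And>a x. a \<in> carrier R \<Longrightarrow> x \<in> J \<Longrightarrow> x \<otimes> a \<in> J"
    "\<And>x n. x \<in> J \<Longrightarrow> component R G x n \<in> J"
proof -
  show J: "ideal J R" using assms by (simp add: homogeneous_ideal_def)
  then interpret ideal J R .
  show "J \<subseteq> carrier R" "\<zero> \<in> J" using a_subset by auto
  show "\<And>x y. x \<in> J \<Longrightarrow> y \<in> J \<Longrightarrow> x \<oplus> y \<in> J" "\<And>x. x \<in> J \<Longrightarrow> \<ominus> x \<in> J"
    "\<And>a x. a \<in> carrier R \<Longrightarrow> x \<in> J \<Longrightarrow> a \<otimes> x \<in> J"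
    "\<And>a x. a \<in> carrier R \<Longrightarrow> x \<in> J \<Longrightarrow> x \<otimes> a \<in> J"
    using I_l_closed I_r_closed by auto
  show "\<And>x n. x \<in> J \<Longrightarrow> component R G x n \<in> J" using assms by (simp add: homogeneous_ideal_iff)
qed

section \<open>Operations on homogeneous ideals\<close>

lemma homogeneous_ideal_inter:
  assumes "homogeneous_ideal R G I" "homogeneous_ideal R G J"
  shows "homogeneous_ideal R G (I \<inter> J)"
  using homogeneous_idealD[OF assms(1)] homogeneous_idealD[OF assms(2)]
  by (intro homogeneous_idealI) auto

lemma mem_set_add_iff: "x \<in> I <+>\<^bsub>R\<^esub> J \<longleftrightarrow> (\<exists>i\<in>I. \<exists>j\<in>J. x = i \<oplus> j)"
  by (auto simp: set_add_def')

lemma homogeneous_ideal_sum: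
  assumes I: "homogeneous_ideal R G I" and J: "homogeneous_ideal R G J"
  shows "homogeneous_ideal R G (I <+>\<^bsub>R\<^esub> J)"
proof -
  note I = homogeneous_idealD[OF I] and J = homogeneous_idealD[OF J]
  have id: "ideal (I <+>\<^bsub>R\<^esub> J) R" using I J by (intro add_ideals) auto
  have "component R G x n \<in> I <+>\<^bsub>R\<^esub> J" if x: "x \<in> I <+>\<^bsub>R\<^esub> J" for x n
  proof -
    obtain i j where ij: "i \<in> I" "j \<in> J" "x = i \<oplus> j"
      using x by (auto simp: mem_set_add_iff)
    then have "component R G x n = component R G i n \<oplus> component R G j n"
      using I J by (auto intro: component_add)
    then show ?thesis using I(8)[OF ij(1)] J(8)[OF ij(2)] unfolding mem_set_add_iff by blast
  qed
  then show ?thesis using id by (simp add: homogeneous_ideal_iff)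
qed

abbreviation principal :: "'a \<Rightarrow> 'a set" where
  "principal x \<equiv> (\<lambda>a. a \<otimes> x) ` carrier R"

lemma homogeneous_ideal_principal:
  assumes "x \<in> G n"
  shows "homogeneous_ideal R G (principal x)"
proof -
  have x: "x \<in> carrier R" using assms degree_carrier by blast
  show ?thesis
  proof (rule homogeneous_idealI)
    show "principal x \<subseteq> carrier R" using x by auto
    have "\<zero> = \<zero> \<otimes> x" using x by simp
    then show "\<zero> \<in> principal x" by blast
  next
    fix y z assume "y \<in> principal x" "z \<in> principal x"
    then obtain a b where "a \<in> carrier R" "b \<in> carrier R" "y = a \<otimes> x" "z = b \<otimes> x" by blast
    then show "y \<oplus> z \<in> principal x"
      using x by (intro image_eqI[of _ _ "a \<oplus> b"]) (auto simp: l_distr)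
  next
    fix a y assume "a \<in> carrier R" "y \<in> principal x"
    then show "a \<otimes> y \<in> principal x"
      using x by (auto simp: m_assoc[symmetric])
  next
    fix y m assume "y \<in> principal x"
    then obtain a where a: "a \<in> carrier R" "y = a \<otimes> x" by blast
    then have "component R G y m = component R G a (m - n) \<otimes> x"
      using component_rmult[OF assms a(1), of "m - n"] by simp
    then show "component R G y m \<in> principal x" using a component_closed by blast
  qed
qed

lemma annihilatorD: "a \<in> annihilator R J \<Longrightarrow> a \<in> carrier R" "a \<in> annihilator R J \<Longrightarrow> x \<in> J \<Longrightarrow> a \<otimes> x = \<zero>"
  by (auto simp: annihilator_def)

lemma annihilator_antimono: "I \<subseteq> J \<Longrightarrow> annihilator R J \<subseteq> annihilator R I"
  by (auto simp: annihilator_def)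

lemma homogeneous_ideal_annihilator:
  assumes "homogeneous_ideal R G J"
  shows "homogeneous_ideal R G (annihilator R J)"
proof (rule homogeneous_idealI)
  note J = homogeneous_idealD[OF assms]
  show "annihilator R J \<subseteq> carrier R" "\<zero> \<in> annihilator R J"
    using J by (auto simp: annihilator_def)
  show "a \<oplus> b \<in> annihilator R J" if "a \<in> annihilator R J" "b \<in> annihilator R J" for a b
    using that J(2) by (auto simp: annihilator_def l_distr subset_iff)
  show "b \<otimes> a \<in> annihilator R J" if "b \<in> carrier R" "a \<in> annihilator R J" for a b
    using that J(2) by (auto simp: annihilator_def m_assoc subset_iff)
  fix a n assume a: "a \<in> annihilator R J"
  then have ac: "a \<in> carrier R" by (rule annihilatorD)
  have "component R G a n \<otimes> x = \<zero>" if x: "x \<in> J" for x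
  proof -
    have xc: "x \<in> carrier R" using x J(2) by blast
    let ?S = "{x \<in> carrier R. component R G a n \<otimes> x = \<zero>}"
    have "x \<in> ?S"
    proof (rule mem_if_components_mem[OF xc])
      fix m
      have "component R G a n \<otimes> component R G x m = component R G (a \<otimes> component R G x m) (n + m)"
        using component_rmult[OF component_degree ac] xc by simp
      also have "\<dots> = \<zero>"
        using annihilatorD(2)[OF a J(8)[OF x]] component_homogeneous[OF zero_degree] by simp
      finally show "component R G x m \<in> ?S" using component_closed xc by simp
    qed (use ac component_closed in \<open>auto simp: r_distr\<close>)
    then show ?thesis by blast
  qed
  then show "component R G a n \<in> annihilator R J"
    using ac component_closed by (auto simp: annihilator_def)
qed

text \<open>Annihilation of a homogeneous ideal is a symmetric notion, although elements need not
  commute up to sign: this is seen on homogeneous components.\<close>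

lemma right_annihilator_iff:
  assumes "homogeneous_ideal R G J"
  shows "a \<in> annihilator R J \<longleftrightarrow> a \<in> carrier R \<and> (\<forall>x\<in>J. x \<otimes> a = \<zero>)"
proof -
  note J = homogeneous_idealD[OF assms]
  have left: "x \<otimes> a = \<zero>" if "x \<in> J" "a \<in> annihilator R J" for x a
  proof -
    have ac: "a \<in> carrier R" using that annihilatorD by blast
    let ?S = "{x \<in> carrier R. x \<otimes> a = \<zero>}"
    have "x \<in> ?S"
    proof (rule mem_if_components_mem)
      fix m
      let ?T = "{b \<in> carrier R. component R G x m \<otimes> b = \<zero>}"
      have xm: "component R G x m \<in> J" using J(8)[OF that(1)] .
      have "a \<in> ?T"
      proof (rule mem_if_components_mem[OF ac])
        fix n
        have an: "component R G a n \<in> annihilator R J"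
          by (rule homogeneous_idealD(8)[OF homogeneous_ideal_annihilator[OF assms] that(2)])
        have "component R G a n \<otimes> component R G x m = \<zero>" using annihilatorD(2)[OF an xm] .
        then show "component R G a n \<in> ?T"
          using graded_commute[of "component R G a n" n "component R G x m" m] component_degree
            component_closed that ac J(2) by (auto split: if_splits)
      qed (use xm J(2) in \<open>auto simp: r_distr subset_iff\<close>)
      then show "component R G x m \<in> ?S" using xm J(2) by blast
    qed (use that J(2) ac in \<open>auto simp: l_distr\<close>)
    then show ?thesis by blast
  qed
  moreover have "a \<in> annihilator R J" if a: "a \<in> carrier R" and 0: "\<forall>x\<in>J. x \<otimes> a = \<zero>"
  proof -
    have "a \<otimes> x = \<zero>" if x: "x \<in> J" for x
    proof -
      have xc: "x \<in> carrier R" using x J(2) by blast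
      let ?S = "{x \<in> carrier R. a \<otimes> x = \<zero>}"
      have "x \<in> ?S"
      proof (rule mem_if_components_mem[OF xc])
        fix m
        have xm: "component R G x m \<in> J" using J(8)[OF x] .
        let ?T = "{b \<in> carrier R. b \<otimes> component R G x m = \<zero>}"
        have "a \<in> ?T"
        proof (rule mem_if_components_mem[OF a])
          fix n
          have "component R G x m \<otimes> component R G a n = component R G (component R G x m \<otimes> a) (n + m)"
            using component_lmult[OF component_degree a] xc by simp
          also have "\<dots> = \<zero>" using 0 xm component_homogeneous[OF zero_degree] by simp
          finally have "component R G x m \<otimes> component R G a n = \<zero>" .
          then show "component R G a n \<in> ?T"
            using graded_commute[of "component R G x m" m "component R G a n" n] component_degree
              component_closed xc a by (auto split: if_splits)
        qed (use xm J(2) in \<open>auto simp: l_distr subset_iff\<close>)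
        then show "component R G x m \<in> ?S" using xm J(2) by blast
      qed (use a in \<open>auto simp: r_distr\<close>)
      then show ?thesis by blast
    qed
    then show ?thesis using a by (simp add: annihilator_def)
  qed
  ultimately show ?thesis using annihilatorD by blast
qed

text \<open>This inclusion rests on the symmetry of annihilation: elements of \<open>J\<close> are killed from the
  left by the annihilator, but must kill it from the left.\<close>

lemma double_annihilator_superset:
  assumes "homogeneous_ideal R G J"
  shows "J \<subseteq> annihilator R (annihilator R J)"
  using right_annihilator_iff[OF assms] homogeneous_idealD(2)[OF assms]
  by (auto simp: annihilator_def)

text \<open>An element that kills \<open>x\<close> kills every \<open>b \<otimes> x\<close>, since this can be rewritten as \<open>x \<otimes> c\<close>.\<close>

lemma mem_annihilator_principal_iff:
  assumes "x \<in> G n"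
  shows "a \<in> annihilator R (principal x) \<longleftrightarrow> a \<in> carrier R \<and> a \<otimes> x = \<zero>"
proof -
  have x: "x \<in> carrier R" using assms degree_carrier by blast
  have "a \<otimes> (b \<otimes> x) = \<zero>" if a: "a \<in> carrier R" "a \<otimes> x = \<zero>" and b: "b \<in> carrier R" for b
  proof -
    obtain c where "c \<in> carrier R" "b \<otimes> x = x \<otimes> c"
      using move_homogeneous_left[OF assms b] by blast
    then show ?thesis using a b x by (simp add: m_assoc[symmetric])
  qed
  moreover have "x \<in> principal x" using x by (metis image_eqI l_one one_closed)
  ultimately show ?thesis by (auto simp: annihilator_def)
qed

end

section \<open>Graded homomorphisms on submodules, as graphs\<close>

text \<open>The graph of a homomorphism of degree \<open>d\<close> from a graded submodule of \<open>N\<close> to \<open>R\<close>. The domain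
  is not a parameter, and its closure properties come with those of the graph. By linearity, single-valuedness
  need only be required over \<open>\<zero>\<close>. With graphs, well-definedness of a map given by a formula in a
  non-unique representation becomes this last clause, and directed unions are set unions.\<close>

definition graded_graph ::
    "('a, 'c) ring_scheme \<Rightarrow> (int \<Rightarrow> 'a set) \<Rightarrow> ('a, 'n, 'e) module_scheme \<Rightarrow> (int \<Rightarrow> 'n set) \<Rightarrow>
     int \<Rightarrow> ('n \<times> 'a) set \<Rightarrow> bool" where
  "graded_graph R G N L d \<Gamma> \<longleftrightarrow>
     \<Gamma> \<subseteq> carrier N \<times> carrier R \<and> (\<zero>\<^bsub>N\<^esub>, \<zero>\<^bsub>R\<^esub>) \<in> \<Gamma> \<and>
     (\<forall>x y x' y'. (x, y) \<in> \<Gamma> \<longrightarrow> (x', y') \<in> \<Gamma> \<longrightarrow> (x \<oplus>\<^bsub>N\<^esub> x', y \<oplus>\<^bsub>R\<^esub> y') \<in> \<Gamma>) \<and>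
     (\<forall>a\<in>carrier R. \<forall>x y. (x, y) \<in> \<Gamma> \<longrightarrow> (a \<odot>\<^bsub>N\<^esub> x, a \<otimes>\<^bsub>R\<^esub> y) \<in> \<Gamma>) \<and>
     (\<forall>x y n. (x, y) \<in> \<Gamma> \<longrightarrow> (component N L x n, component R G y (n + d)) \<in> \<Gamma>) \<and>
     (\<forall>y. (\<zero>\<^bsub>N\<^esub>, y) \<in> \<Gamma> \<longrightarrow> y = \<zero>\<^bsub>R\<^esub>)"

lemma graded_graphI:
  assumes "\<And>x y. (x, y) \<in> \<Gamma> \<Longrightarrow> x \<in> carrier N" "\<And>x y. (x, y) \<in> \<Gamma> \<Longrightarrow> y \<in> carrier R"
    and "(\<zero>\<^bsub>N\<^esub>, \<zero>\<^bsub>R\<^esub>) \<in> \<Gamma>"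
    and "\<And>x y x' y'. (x, y) \<in> \<Gamma> \<Longrightarrow> (x', y') \<in> \<Gamma> \<Longrightarrow> (x \<oplus>\<^bsub>N\<^esub> x', y \<oplus>\<^bsub>R\<^esub> y') \<in> \<Gamma>"
    and "\<And>a x y. a \<in> carrier R \<Longrightarrow> (x, y) \<in> \<Gamma> \<Longrightarrow> (a \<odot>\<^bsub>N\<^esub> x, a \<otimes>\<^bsub>R\<^esub> y) \<in> \<Gamma>"
    and "\<And>x y n. (x, y) \<in> \<Gamma> \<Longrightarrow> (component N L x n, component R G y (n + d)) \<in> \<Gamma>"
    and "\<And>y. (\<zero>\<^bsub>N\<^esub>, y) \<in> \<Gamma> \<Longrightarrow> y = \<zero>\<^bsub>R\<^esub>"
  shows "graded_graph R G N L d \<Gamma>"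
  unfolding graded_graph_def
proof (intro conjI allI ballI impI)
  show "\<Gamma> \<subseteq> carrier N \<times> carrier R" using assms(1,2) by auto
qed (fact assms(3-7))+

lemma graded_graphD:
  assumes "graded_graph R G N L d \<Gamma>"
  shows "\<And>x y. (x, y) \<in> \<Gamma> \<Longrightarrow> x \<in> carrier N"
    and "\<And>x y. (x, y) \<in> \<Gamma> \<Longrightarrow> y \<in> carrier R"
    and "(\<zero>\<^bsub>N\<^esub>, \<zero>\<^bsub>R\<^esub>) \<in> \<Gamma>"
    and "\<And>x y x' y'. (x, y) \<in> \<Gamma> \<Longrightarrow> (x', y') \<in> \<Gamma> \<Longrightarrow> (x \<oplus>\<^bsub>N\<^esub> x', y \<oplus>\<^bsub>R\<^esub> y') \<in> \<Gamma>"
    and "\<And>a x y. a \<in> carrier R \<Longrightarrow> (x, y) \<in> \<Gamma> \<Longrightarrow> (a \<odot>\<^bsub>N\<^esub> x, a \<otimes>\<^bsub>R\<^esub> y) \<in> \<Gamma>"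
    and "\<And>x y n. (x, y) \<in> \<Gamma> \<Longrightarrow> (component N L x n, component R G y (n + d)) \<in> \<Gamma>"
    and "\<And>y. (\<zero>\<^bsub>N\<^esub>, y) \<in> \<Gamma> \<Longrightarrow> y = \<zero>\<^bsub>R\<^esub>"
  using assms unfolding graded_graph_def by (elim conjE; blast)+

context left_module
begin

lemma smult_l_zero:
  assumes "x \<in> carrier M"
  shows "\<zero>\<^bsub>R\<^esub> \<odot>\<^bsub>M\<^esub> x = \<zero>\<^bsub>M\<^esub>"
proof -
  have "\<zero>\<^bsub>R\<^esub> \<odot>\<^bsub>M\<^esub> x \<oplus>\<^bsub>M\<^esub> \<zero>\<^bsub>R\<^esub> \<odot>\<^bsub>M\<^esub> x = \<zero>\<^bsub>R\<^esub> \<odot>\<^bsub>M\<^esub> x"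
    using smult_l_distr[OF R.zero_closed R.zero_closed assms] by simp
  then show ?thesis using smult_closed[OF R.zero_closed assms] by simp
qed

lemma smult_l_minus:
  assumes "a \<in> carrier R" "x \<in> carrier M"
  shows "(\<ominus>\<^bsub>R\<^esub> a) \<odot>\<^bsub>M\<^esub> x = \<ominus>\<^bsub>M\<^esub> (a \<odot>\<^bsub>M\<^esub> x)"
proof -
  have "(\<ominus>\<^bsub>R\<^esub> a) \<odot>\<^bsub>M\<^esub> x \<oplus>\<^bsub>M\<^esub> a \<odot>\<^bsub>M\<^esub> x = \<zero>\<^bsub>M\<^esub>"
    using smult_l_distr[of "\<ominus>\<^bsub>R\<^esub> a" a x] assms smult_l_zero by (simp add: R.l_neg)
  then show ?thesis using M.minus_equality assms smult_closed by simp
qed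

lemma graded_graph_minus:
  assumes "graded_graph R G M L d \<Gamma>" "(x, y) \<in> \<Gamma>"
  shows "(\<ominus>\<^bsub>M\<^esub> x, \<ominus>\<^bsub>R\<^esub> y) \<in> \<Gamma>"
proof -
  note \<Gamma> = graded_graphD[OF assms(1)]
  have "((\<ominus>\<^bsub>R\<^esub> \<one>\<^bsub>R\<^esub>) \<odot>\<^bsub>M\<^esub> x, (\<ominus>\<^bsub>R\<^esub> \<one>\<^bsub>R\<^esub>) \<otimes>\<^bsub>R\<^esub> y) \<in> \<Gamma>"
    using assms(2) by (intro \<Gamma>(5)) auto
  then show ?thesis
    using \<Gamma>(1,2)[OF assms(2)] by (simp add: smult_l_minus smult_one R.l_minus)
qed

text \<open>The difference of two pairs over the same \<open>x\<close> lies over \<open>\<zero>\<close>.\<close>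

lemma graded_graph_single_valued:
  assumes "graded_graph R G M L d \<Gamma>" "(x, y) \<in> \<Gamma>" "(x, y') \<in> \<Gamma>"
  shows "y = y'"
proof -
  note \<Gamma> = graded_graphD[OF assms(1)]
  have "(x \<oplus>\<^bsub>M\<^esub> \<ominus>\<^bsub>M\<^esub> x, y \<oplus>\<^bsub>R\<^esub> \<ominus>\<^bsub>R\<^esub> y') \<in> \<Gamma>"
    using \<Gamma>(4)[OF assms(2) graded_graph_minus[OF assms(1,3)]] .
  then have "y \<oplus>\<^bsub>R\<^esub> \<ominus>\<^bsub>R\<^esub> y' = \<zero>\<^bsub>R\<^esub>"
    using \<Gamma>(1)[OF assms(2)] \<Gamma>(7) by (simp add: M.r_neg)
  then show ?thesis
    using \<Gamma>(2)[OF assms(2)] \<Gamma>(2)[OF assms(3)] R.minus_equality[of y "\<ominus>\<^bsub>R\<^esub> y'"] by simp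
qed

end

context graded_module
begin

lemma component_smult_element:
  assumes "x \<in> H m" "a \<in> carrier R"
  shows "component M H (a \<odot>\<^bsub>M\<^esub> x) (n + m) = component R G a n \<odot>\<^bsub>M\<^esub> x"
  by (rule component_additive_map[where f = "\<lambda>a. a \<odot>\<^bsub>M\<^esub> x"])
    (use assms N.degree_carrier[OF assms(1)] smult_degree[OF _ assms(1)]
      N.graded_abelian_group_axioms smult_closed smult_l_distr in auto)

end

section \<open>Ideals with shifted grading\<close>

text \<open>The ideal \<open>D\<close> as a left module. A homomorphism of degree \<open>d\<close> on \<open>D\<close> becomes one of degree zero
  once \<open>D\<close> carries the grading \<open>n \<mapsto> D \<inter> G (n - d)\<close>; shifting a left module does not change the scalar
  multiplication, so no signs appear.\<close>

abbreviation ideal_module :: "('a, 'c) ring_scheme \<Rightarrow> 'a set \<Rightarrow> ('a, 'a) module" where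
  "ideal_module R D \<equiv> regular_module R\<lparr>carrier := D\<rparr>"

lemma regular_module_simps [simp]:
  "carrier (regular_module R) = carrier R" "add (regular_module R) = add R"
  "\<zero>\<^bsub>regular_module R\<^esub> = \<zero>\<^bsub>R\<^esub>" "smult (regular_module R) = monoid.mult R"
  by (simp_all add: regular_module_def)

lemma ideal_module_carrier: "ideal_module R (carrier R) = regular_module R"
  by (simp add: regular_module_def)

lemma finsum_regular_module: "finsum (regular_module R) = finsum R"
  by (intro ext) (simp add: finsum_def finprod_def regular_module_def)

lemma component_regular_module [simp]: "component (regular_module R) = component R"
  unfolding component_def homogeneous_decomposition_def
  by (intro ext) (simp add: finsum_regular_module)

context graded_commutative_ring
begin

lemma abelian_group_ideal_module:
  assumes "homogeneous_ideal R G D"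
  shows "abelian_group (ideal_module R D)"
proof -
  note D = homogeneous_idealD[OF assms]
  have c: "x \<in> carrier R" if "x \<in> D" for x using D(2) that by blast
  show ?thesis
  proof (rule abelian_groupI)
    fix x assume "x \<in> carrier (ideal_module R D)"
    then have "x \<in> D" by simp
    then show "\<exists>y\<in>carrier (ideal_module R D). y \<oplus>\<^bsub>ideal_module R D\<^esub> x = \<zero>\<^bsub>ideal_module R D\<^esub>"
      using c D(5) by (auto intro!: bexI[of _ "\<ominus> x"] simp: l_neg)
  qed (use D(3,4) c in \<open>auto simp: a_ac\<close>)
qed

lemma finsum_ideal_module:
  assumes "homogeneous_ideal R G D" "finite T" "\<And>n. c n \<in> D"
  shows "finsum (ideal_module R D) c T = finsum R c T"
proof -
  interpret D: abelian_group "ideal_module R D"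
    using assms(1) by (rule abelian_group_ideal_module)
  have "c n \<in> carrier R" for n using assms(3) homogeneous_idealD(2)[OF assms(1)] by blast
  with assms(2) show ?thesis
    by (induction T rule: finite_induct) (simp_all add: assms(3) Pi_def)
qed

text \<open>Existence and uniqueness of decompositions in the shifted ideal are both read off from the
  decompositions in \<open>R\<close>.\<close>

lemma decomposition_ideal_module_iff:
  assumes "homogeneous_ideal R G D"
  shows "homogeneous_decomposition (ideal_module R D) (\<lambda>n. D \<inter> G (n - d)) x c \<longleftrightarrow>
    (\<forall>n. c n \<in> D) \<and> homogeneous_decomposition R G x (\<lambda>n. c (n + d))"
proof (cases "\<forall>n. c n \<in> D")
  case True
  have cR: "c n \<in> carrier R" for n using True homogeneous_idealD(2)[OF assms] by blast
  let ?S = "{n. c n \<noteq> \<zero>}" and ?T = "{n. c (n + d) \<noteq> \<zero>}"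
  have img: "?S = (\<lambda>n. n + d) ` ?T"
    by (auto simp: image_iff) (metis diff_add_cancel)
  have inj: "inj_on (\<lambda>n::int. n + d) ?T" by (simp add: inj_on_def)
  have fin: "finite ?S \<longleftrightarrow> finite ?T" using img inj finite_image_iff by metis
  have sum: "finsum R c ?S = finsum R (\<lambda>n. c (n + d)) ?T"
    unfolding img by (rule finsum_reindex) (use cR inj in auto)
  have deg: "(\<forall>n. c n \<in> G (n - d)) \<longleftrightarrow> (\<forall>n. c (n + d) \<in> G n)"
    by (metis add_diff_cancel_right' diff_add_cancel)
  show ?thesis
    unfolding homogeneous_decomposition_def
    using True fin sum deg finsum_ideal_module[OF assms, of ?S c] by auto
qed (auto simp: homogeneous_decomposition_def)

lemma graded_module_ideal_module:
  assumes "homogeneous_ideal R G D"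
  shows "graded_module R G (ideal_module R D) (\<lambda>n. D \<inter> G (n - d))"
proof -
  note D = homogeneous_idealD[OF assms]
  let ?M = "ideal_module R D" and ?H = "\<lambda>n. D \<inter> G (n - d)"
  have c: "x \<in> carrier R" if "x \<in> D" for x using D(2) that by blast
  interpret M: abelian_group ?M
    using assms by (rule abelian_group_ideal_module)
  have minus: "\<ominus>\<^bsub>?M\<^esub> x = \<ominus> x" if "x \<in> D" for x
    by (rule M.minus_equality) (use that c D(5) l_neg in auto)
  have sub: "additive_subgroup (?H n) ?M" for n
  proof -
    interpret G: additive_subgroup "G (n - d)" R by (rule degree_subgroup)
    have "subgroup (?H n) (add_monoid ?M)"
    proof (rule M.add.subgroupI)
      show "?H n \<noteq> {}" using D(3) G.zero_closed by blast
      show "\<ominus>\<^bsub>?M\<^esub> x \<in> ?H n" if "x \<in> ?H n" for x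
        using that minus[of x] D(5) G.a_inv_closed by simp
    qed (use D(4) in auto)
    then show ?thesis by (rule additive_subgroup.intro)
  qed
  have uniq: "\<exists>!c. homogeneous_decomposition ?M ?H x c" if x: "x \<in> carrier ?M" for x
  proof -
    have xD: "x \<in> D" using x by simp
    have "homogeneous_decomposition ?M ?H x (\<lambda>n. component R G x (n - d))"
      unfolding decomposition_ideal_module_iff[OF assms]
      using D(8)[OF xD] component_decomposition[OF c[OF xD]] by simp
    moreover have "c = (\<lambda>n. component R G x (n - d))" if "homogeneous_decomposition ?M ?H x c" for c
    proof -
      have "(\<lambda>n. c (n + d)) = component R G x"
        using that decomposition_eq_component unfolding decomposition_ideal_module_iff[OF assms]
        by blast
      then show ?thesis by (metis diff_add_cancel)
    qed
    ultimately show ?thesis by blast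
  qed
  show ?thesis
  proof unfold_locales
    show "grading ?M ?H" unfolding grading_def using sub uniq by blast
    show "a \<odot>\<^bsub>?M\<^esub> x \<in> ?H (m + n)" if "a \<in> G m" "x \<in> ?H n" for a x m n
      using that mult_degree[of a m x "n - d"] D(6) degree_carrier by (auto simp: algebra_simps)
  qed (use D(6) c in \<open>auto simp: l_distr r_distr m_assoc\<close>)
qed

lemma homogeneous_ideal_carrier: "homogeneous_ideal R G (carrier R)"
  by (rule homogeneous_idealI) (auto intro: component_closed)

lemma graded_module_regular: "graded_module R G (regular_module R) G"
proof -
  have "(\<lambda>n. carrier R \<inter> G (n - 0)) = G" using degree_carrier by auto
  then show ?thesis
    using graded_module_ideal_module[OF homogeneous_ideal_carrier, of 0]
    by (simp only: ideal_module_carrier)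
qed

end

section \<open>Baer's criterion\<close>

text \<open>Baer's criterion, quantified over the graphs of the partial homomorphisms.\<close>

definition graded_baer :: "('a, 'c) ring_scheme \<Rightarrow> (int \<Rightarrow> 'a set) \<Rightarrow> bool" where
  "graded_baer R G \<longleftrightarrow>
     (\<forall>d \<Gamma>. graded_graph R G (regular_module R) G d \<Gamma> \<longrightarrow>
        (\<exists>r\<in>G d. \<forall>(x, y)\<in>\<Gamma>. y = x \<otimes>\<^bsub>R\<^esub> r))"

context graded_commutative_ring
begin

lemma left_module_regular: "left_module R (regular_module R)"
  using graded_module_regular by (rule graded_module.axioms(2))

lemma homogeneous_ideal_Domain:
  assumes "graded_graph R G (regular_module R) G d \<Gamma>"
  shows "homogeneous_ideal R G (Domain \<Gamma>)"
proof -
  note \<Gamma> = graded_graphD[OF assms, simplified]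
  show ?thesis
    by (rule homogeneous_idealI; blast intro: \<Gamma>(1,3-6))
qed

text \<open>The test modules are ideals of \<open>R\<close> with shifted grading, so injectivity against modules on the
  element type of \<open>R\<close> suffices. The standard proof of the double annihilator condition, which maps
  \<open>R / ann(J)\<close> into a power of \<open>R\<close>, would leave that type.\<close>

lemma graded_baer_if_self_injective:
  assumes "graded_self_injective TYPE('a) R G"
  shows "graded_baer R G"
  unfolding graded_baer_def
proof (intro allI impI)
  fix d \<Gamma> assume graph: "graded_graph R G (regular_module R) G d \<Gamma>"
  note \<Gamma> = graded_graphD[OF graph, simplified]
  define D where "D = Domain \<Gamma>"
  define f where "f x = (THE y. (x, y) \<in> \<Gamma>)" for x
  have f: "f x = y" if "(x, y) \<in> \<Gamma>" for x y
    unfolding f_def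
    using that left_module.graded_graph_single_valued[OF left_module_regular graph]
    by (intro the_equality) auto
  have fD: "(x, f x) \<in> \<Gamma>" if "x \<in> D" for x
    using that f unfolding D_def by blast
  have D: "homogeneous_ideal R G D"
    unfolding D_def using graph by (rule homogeneous_ideal_Domain)
  let ?M = "ideal_module R D" and ?N = "ideal_module R (carrier R)"
  let ?H = "\<lambda>n. D \<inter> G (n - d)" and ?L = "\<lambda>n. carrier R \<inter> G (n - d)"
  have incl: "graded_module_hom R ?M ?H ?N ?L id"
    using homogeneous_idealD(2)[OF D] by (auto simp: graded_module_hom_def hom_def)
  have hom: "graded_module_hom R ?M ?H (regular_module R) G f"
    unfolding graded_module_hom_def
  proof (intro conjI ballI allI)
    show "f \<in> hom (add_monoid ?M) (add_monoid (regular_module R))"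
      using \<Gamma>(2)[OF fD] f[OF \<Gamma>(4)[OF fD fD]] by (simp add: hom_def)
    show "f (a \<odot>\<^bsub>?M\<^esub> x) = a \<odot>\<^bsub>regular_module R\<^esub> f x" if "a \<in> carrier R" "x \<in> carrier ?M" for a x
      using that f[OF \<Gamma>(5)[OF _ fD]] by simp
    fix n
    show "f ` ?H n \<subseteq> G n"
    proof clarify
      fix x assume x: "x \<in> D" "x \<in> G (n - d)"
      have "(component R G x (n - d), component R G (f x) (n - d + d)) \<in> \<Gamma>"
        using \<Gamma>(6)[OF fD[OF x(1)]] .
      then have "(x, component R G (f x) n) \<in> \<Gamma>"
        using component_homogeneous[OF x(2)] by simp
      then have "f x = component R G (f x) n" by (rule f)
      then show "f x \<in> G n" using component_degree[OF \<Gamma>(2)[OF fD[OF x(1)]], of n] by simp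
    qed
  qed
  obtain g where g: "graded_module_hom R ?N ?L (regular_module R) G g" "\<And>x. x \<in> D \<Longrightarrow> g x = f x"
  proof -
    have "inj_on id (carrier ?M)" by simp
    then show ?thesis
      using assms incl hom graded_module_ideal_module[OF D, of d]
        graded_module_ideal_module[OF homogeneous_ideal_carrier, of d] that
      unfolding graded_self_injective_def graded_injective_def by fastforce
  qed
  have "g \<one> \<in> G d"
  proof -
    have "\<one> \<in> ?L d" using one_degree by simp
    then show ?thesis using g(1) unfolding graded_module_hom_def by blast
  qed
  moreover have "y = x \<otimes> g \<one>" if xy: "(x, y) \<in> \<Gamma>" for x y
  proof -
    have x: "x \<in> carrier R" using \<Gamma>(1) xy .
    have lin: "\<forall>a\<in>carrier R. \<forall>x\<in>carrier R. g (a \<otimes> x) = a \<otimes> g x"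
      using g(1) by (simp add: graded_module_hom_def)
    have "y = g x" using f[OF xy] g(2)[of x] DomainI[OF xy] by (simp add: D_def)
    also have "\<dots> = g (x \<otimes> \<one>)" using x by simp
    also have "\<dots> = x \<otimes> g \<one>"
      using lin x one_closed by blast
    finally show ?thesis .
  qed
  ultimately show "\<exists>r\<in>G d. \<forall>(x, y)\<in>\<Gamma>. y = x \<otimes> r" by blast
qed

section \<open>From Baer's criterion to double annihilators\<close>

text \<open>For homogeneous \<open>y\<close> in the double annihilator, everything that kills \<open>x\<close> kills \<open>y\<close>, so
  \<open>a \<otimes> x \<mapsto> a \<otimes> y\<close> is a homomorphism; Baer's criterion writes \<open>y\<close> as a right multiple of \<open>x\<close>.\<close>

lemma double_annihilator_principal:
  assumes baer: "graded_baer R G" and x: "x \<in> G n"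
  shows "annihilator R (annihilator R (principal x)) \<subseteq> principal x"
proof
  fix y assume y: "y \<in> annihilator R (annihilator R (principal x))"
  have px: "homogeneous_ideal R G (principal x)" using x by (rule homogeneous_ideal_principal)
  note P = homogeneous_idealD[OF px]
  have A: "homogeneous_ideal R G (annihilator R (principal x))"
    using px by (rule homogeneous_ideal_annihilator)
  have AA: "homogeneous_ideal R G (annihilator R (annihilator R (principal x)))"
    using A by (rule homogeneous_ideal_annihilator)
  have xc: "x \<in> carrier R" using x degree_carrier by blast
  have yc: "y \<in> carrier R" using y by (rule annihilatorD)
  show "y \<in> principal x"
  proof (rule mem_if_components_mem[OF yc])
    fix m
    let ?y = "component R G y m"
    have ym: "?y \<in> G m" "?y \<in> carrier R" using yc component_degree component_closed by auto
    have "?y \<in> annihilator R (annihilator R (principal x))"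
      using homogeneous_idealD(8)[OF AA y] .
    then have kill: "a \<otimes> ?y = \<zero>" if "a \<in> carrier R" "a \<otimes> x = \<zero>" for a
      using that right_annihilator_iff[OF A] mem_annihilator_principal_iff[OF x] by blast
    let ?\<Gamma> = "(\<lambda>a. (a \<otimes> x, a \<otimes> ?y)) ` carrier R"
    have "graded_graph R G (regular_module R) G (m - n) ?\<Gamma>"
    proof (rule graded_graphI, simp_all only: regular_module_simps component_regular_module)
      show "(\<zero>, \<zero>) \<in> ?\<Gamma>" by (rule image_eqI[of _ _ \<zero>]) (use xc ym in auto)
    next
      fix u v u' v' assume "(u, v) \<in> ?\<Gamma>" "(u', v') \<in> ?\<Gamma>"
      then obtain a b where "a \<in> carrier R" "b \<in> carrier R" "u = a \<otimes> x" "v = a \<otimes> ?y"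
        "u' = b \<otimes> x" "v' = b \<otimes> ?y" by blast
      then show "(u \<oplus> u', v \<oplus> v') \<in> ?\<Gamma>"
        by (intro image_eqI[of _ _ "a \<oplus> b"]) (use xc ym in \<open>auto simp: l_distr\<close>)
    next
      fix a u v assume "a \<in> carrier R" "(u, v) \<in> ?\<Gamma>"
      moreover from this obtain b where "b \<in> carrier R" "u = b \<otimes> x" "v = b \<otimes> ?y" by blast
      ultimately show "(a \<otimes> u, a \<otimes> v) \<in> ?\<Gamma>"
        by (intro image_eqI[of _ _ "a \<otimes> b"]) (use xc ym in \<open>auto simp: m_assoc\<close>)
    next
      fix u v k assume "(u, v) \<in> ?\<Gamma>"
      then obtain a where a: "a \<in> carrier R" "u = a \<otimes> x" "v = a \<otimes> ?y" by blast
      have "component R G u k = component R G a (k - n) \<otimes> x"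
        using component_rmult[OF x a(1), of "k - n"] a by simp
      moreover have "component R G v (k + (m - n)) = component R G a (k - n) \<otimes> ?y"
        using component_rmult[OF ym(1) a(1), of "k - n"] a by (simp add: algebra_simps)
      ultimately show "(component R G u k, component R G v (k + (m - n))) \<in> ?\<Gamma>"
        using component_closed[OF a(1)] by blast
    qed (use xc ym kill in auto)
    then obtain r where r: "r \<in> G (m - n)" "\<forall>(u, v)\<in>?\<Gamma>. v = u \<otimes> r"
      using baer unfolding graded_baer_def by blast
    have rc: "r \<in> carrier R" using r(1) degree_carrier by blast
    have "(\<one> \<otimes> x, \<one> \<otimes> ?y) \<in> ?\<Gamma>" by blast
    then have "?y = x \<otimes> r" using r(2) xc ym by fastforce
    moreover have "x \<in> principal x" using xc by (metis image_eqI l_one one_closed)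
    ultimately show "?y \<in> principal x" using P(7)[OF rc] by simp
  qed (use P in auto)
qed

text \<open>For homogeneous \<open>a\<close> killing \<open>I \<inter> J\<close>, the map sending \<open>i \<oplus> j\<close> to \<open>i \<otimes> a\<close> is well defined. If it is
  multiplication by \<open>r\<close>, then \<open>r\<close> agrees with \<open>a\<close> on \<open>I\<close> and with \<open>\<zero>\<close> on \<open>J\<close>.\<close>

lemma annihilator_inter_subset:
  assumes baer: "graded_baer R G"
    and I: "homogeneous_ideal R G I" and J: "homogeneous_ideal R G J"
  shows "annihilator R (I \<inter> J) \<subseteq> annihilator R I <+>\<^bsub>R\<^esub> annihilator R J"
proof
  note Id = homogeneous_idealD[OF I] and Jd = homogeneous_idealD[OF J]
  have IJ: "homogeneous_ideal R G (I \<inter> J)" using I J by (rule homogeneous_ideal_inter)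
  have S: "homogeneous_ideal R G (annihilator R I <+>\<^bsub>R\<^esub> annihilator R J)"
    using I J by (intro homogeneous_ideal_sum homogeneous_ideal_annihilator)
  have c: "i \<in> carrier R" if "i \<in> I \<or> i \<in> J" for i using that Id(2) Jd(2) by blast
  fix a assume a: "a \<in> annihilator R (I \<inter> J)"
  then have ac: "a \<in> carrier R" by (rule annihilatorD)
  show "a \<in> annihilator R I <+>\<^bsub>R\<^esub> annihilator R J"
  proof (rule mem_if_components_mem[OF ac])
    fix d
    let ?a = "component R G a d"
    have am: "?a \<in> G d" "?a \<in> carrier R" using ac component_degree component_closed by auto
    have "?a \<in> annihilator R (I \<inter> J)"
      using homogeneous_idealD(8)[OF homogeneous_ideal_annihilator[OF IJ] a] .
    then have kill: "z \<otimes> ?a = \<zero>" if "z \<in> I" "z \<in> J" for z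
      using that right_annihilator_iff[OF IJ] by blast
    let ?\<Gamma> = "(\<lambda>(i, j). (i \<oplus> j, i \<otimes> ?a)) ` (I \<times> J)"
    have mem: "(i \<oplus> j, i \<otimes> ?a) \<in> ?\<Gamma>" if "i \<in> I" "j \<in> J" for i j
      using that by (auto intro!: image_eqI[of _ _ "(i, j)"])
    have memE: "\<exists>i\<in>I. \<exists>j\<in>J. u = i \<oplus> j \<and> v = i \<otimes> ?a" if "(u, v) \<in> ?\<Gamma>" for u v
      using that by auto
    have "graded_graph R G (regular_module R) G d ?\<Gamma>"
    proof (rule graded_graphI, simp_all only: regular_module_simps component_regular_module)
      show "(\<zero>, \<zero>) \<in> ?\<Gamma>" using mem[OF Id(3) Jd(3)] am by simp
    next
      fix u v u' v' assume "(u, v) \<in> ?\<Gamma>" "(u', v') \<in> ?\<Gamma>"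
      from memE[OF this(1)] memE[OF this(2)]
      obtain i j i' j' where *: "i \<in> I" "j \<in> J" "i' \<in> I" "j' \<in> J"
        and uv: "u = i \<oplus> j" "v = i \<otimes> ?a" "u' = i' \<oplus> j'" "v' = i' \<otimes> ?a" by blast
      have cc: "i \<in> carrier R" "j \<in> carrier R" "i' \<in> carrier R" "j' \<in> carrier R"
        using * c by blast+
      have "u \<oplus> u' = (i \<oplus> i') \<oplus> (j \<oplus> j')" "v \<oplus> v' = (i \<oplus> i') \<otimes> ?a"
        using cc am uv by (simp_all add: a_ac l_distr)
      then show "(u \<oplus> u', v \<oplus> v') \<in> ?\<Gamma>"
        using mem[OF Id(4)[OF *(1,3)] Jd(4)[OF *(2,4)]] by simp
    next
      fix b u v assume b: "b \<in> carrier R" and "(u, v) \<in> ?\<Gamma>"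
      from memE[OF this(2)] obtain i j where *: "i \<in> I" "j \<in> J" and uv: "u = i \<oplus> j" "v = i \<otimes> ?a" by blast
      have cc: "i \<in> carrier R" "j \<in> carrier R" using * c by blast+
      have "b \<otimes> u = b \<otimes> i \<oplus> b \<otimes> j" "b \<otimes> v = b \<otimes> i \<otimes> ?a"
        using cc am b uv by (simp_all add: r_distr m_assoc)
      then show "(b \<otimes> u, b \<otimes> v) \<in> ?\<Gamma>"
        using mem[OF Id(6)[OF b *(1)] Jd(6)[OF b *(2)]] by simp
    next
      fix u v k assume "(u, v) \<in> ?\<Gamma>"
      from memE[OF this] obtain i j where *: "i \<in> I" "j \<in> J" and uv: "u = i \<oplus> j" "v = i \<otimes> ?a" by blast
      have cc: "i \<in> carrier R" "j \<in> carrier R" using * c by blast+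
      have "component R G u k = component R G i k \<oplus> component R G j k"
        using cc uv component_add by simp
      moreover have "component R G v (k + d) = component R G i k \<otimes> ?a"
        using component_rmult[OF am(1) cc(1)] uv by simp
      ultimately show "(component R G u k, component R G v (k + d)) \<in> ?\<Gamma>"
        using mem[OF Id(8)[OF *(1)] Jd(8)[OF *(2)]] by simp
    next
      fix v assume "(\<zero>, v) \<in> ?\<Gamma>"
      from memE[OF this] obtain i j where *: "i \<in> I" "j \<in> J" and uv: "\<zero> = i \<oplus> j" "v = i \<otimes> ?a" by blast
      have cc: "i \<in> carrier R" "j \<in> carrier R" using * c by blast+
      have "i = \<ominus> j" using minus_equality[of i j] cc uv by simp
      then show "v = \<zero>" using kill[OF *(1)] Jd(5)[OF *(2)] uv by simp
    qed (use c am in auto)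
    then obtain r where r: "r \<in> G d" "\<forall>(u, v)\<in>?\<Gamma>. v = u \<otimes> r"
      using baer unfolding graded_baer_def by blast
    have rc: "r \<in> carrier R" using r(1) degree_carrier by blast
    have "z \<otimes> (?a \<ominus> r) = \<zero>" if z: "z \<in> I" for z
    proof -
      have zc: "z \<in> carrier R" using z c by blast
      have "z \<otimes> ?a = (z \<oplus> \<zero>) \<otimes> r" using r(2) mem[OF z Jd(3)] by blast
      then show ?thesis using zc am rc by (simp add: a_minus_def r_distr r_minus r_neg)
    qed
    then have 1: "?a \<ominus> r \<in> annihilator R I"
      using right_annihilator_iff[OF I] am rc by simp
    have "z \<otimes> r = \<zero>" if z: "z \<in> J" for z
    proof -
      have zc: "z \<in> carrier R" using z c by blast
      have "\<zero> \<otimes> ?a = (\<zero> \<oplus> z) \<otimes> r" using r(2) mem[OF Id(3) z] by blast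
      then show ?thesis using zc am rc by simp
    qed
    then have 2: "r \<in> annihilator R J"
      using right_annihilator_iff[OF J] rc by simp
    have "?a = (?a \<ominus> r) \<oplus> r" using am rc by (simp add: a_minus_def a_assoc l_neg)
    then show "?a \<in> annihilator R I <+>\<^bsub>R\<^esub> annihilator R J"
      using 1 2 unfolding mem_set_add_iff by blast
  qed (use homogeneous_idealD(3,4)[OF S] in auto)
qed

lemma Idl_insert:
  assumes "S \<subseteq> (\<Union>n. G n)" "x \<in> G n" "homogeneous_ideal R G (Idl S)"
  shows "Idl (insert x S) = Idl S <+>\<^bsub>R\<^esub> principal x"
proof -
  have x: "x \<in> carrier R" and S: "S \<subseteq> carrier R" using assms degree_carrier by auto
  note I = homogeneous_idealD[OF assms(3)]
  note P = homogeneous_idealD[OF homogeneous_ideal_principal[OF assms(2)]]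
  have xp: "x \<in> principal x" using x by (metis image_eqI l_one one_closed)
  interpret J: ideal "Idl (insert x S)" R using x S by (intro genideal_ideal) auto
  have "insert x S \<subseteq> Idl (insert x S)" using x S by (intro genideal_self) auto
  then have "Idl S \<subseteq> Idl (insert x S)" "principal x \<subseteq> Idl (insert x S)"
    using genideal_minimal[OF J.ideal_axioms] J.I_l_closed by auto
  then have "Idl S <+>\<^bsub>R\<^esub> principal x \<subseteq> Idl (insert x S)"
    using J.a_closed unfolding subset_iff mem_set_add_iff by blast
  moreover have "Idl (insert x S) \<subseteq> Idl S <+>\<^bsub>R\<^esub> principal x"
  proof (rule genideal_minimal)
    show "ideal (Idl S <+>\<^bsub>R\<^esub> principal x) R" using I(1) P(1) by (rule add_ideals)
    have "x = \<zero> \<oplus> x" "\<And>s. s \<in> S \<Longrightarrow> s = s \<oplus> \<zero>" using x S by auto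
    then show "insert x S \<subseteq> Idl S <+>\<^bsub>R\<^esub> principal x"
      using I(3) P(3) xp genideal_self[OF S] unfolding subset_iff mem_set_add_iff insert_iff by metis
  qed
  ultimately show ?thesis by blast
qed

text \<open>Induction on the homogeneous generators. The formula for \<open>ann(I \<inter> J)\<close> is applied to the
  annihilators of the two summands, whose intersection annihilates the sum.\<close>

lemma double_annihilator_if_baer:
  assumes baer: "graded_baer R G"
  shows "double_annihilator_condition R G"
proof -
  have main: "homogeneous_ideal R G (Idl S) \<and> annihilator R (annihilator R (Idl S)) \<subseteq> Idl S"
    if "finite S" "S \<subseteq> (\<Union>n. G n)" for S
    using that
  proof (induction S rule: finite_induct)
    case empty
    have "\<one> \<in> annihilator R {\<zero>}" by (simp add: annihilator_def)
    then have "annihilator R (annihilator R {\<zero>}) \<subseteq> {\<zero>}"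
      by (auto simp: annihilator_def dest: bspec[of _ _ \<one>])
    moreover have "homogeneous_ideal R G {\<zero>}"
      by (rule homogeneous_idealI) (use component_homogeneous[OF zero_degree] in auto)
    moreover have "Idl {} = {\<zero>}"
      using genideal_minimal[OF zeroideal, of "{}"]
        additive_subgroup.zero_closed[OF ideal.axioms(1)[OF genideal_ideal[of "{}"]]] by auto
    ultimately show ?case by simp
  next
    case (insert x S)
    then obtain n where x: "x \<in> G n" by blast
    let ?I = "Idl S" and ?P = "principal x"
    have I: "homogeneous_ideal R G ?I" and AI: "annihilator R (annihilator R ?I) \<subseteq> ?I"
      using insert by auto
    have P: "homogeneous_ideal R G ?P" using x by (rule homogeneous_ideal_principal)
    note AP = double_annihilator_principal[OF baer x]
    have hom: "homogeneous_ideal R G (annihilator R ?I)" "homogeneous_ideal R G (annihilator R ?P)"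
      using I P by (auto intro: homogeneous_ideal_annihilator)
    have eq: "Idl (insert x S) = ?I <+>\<^bsub>R\<^esub> ?P"
      using insert x I by (intro Idl_insert) auto
    have "annihilator R ?I \<inter> annihilator R ?P \<subseteq> annihilator R (?I <+>\<^bsub>R\<^esub> ?P)"
    proof
      fix a assume a: "a \<in> annihilator R ?I \<inter> annihilator R ?P"
      have "a \<otimes> (i \<oplus> j) = \<zero>" if "i \<in> ?I" "j \<in> ?P" for i j
        using that a homogeneous_idealD(2)[OF I] homogeneous_idealD(2)[OF P]
        by (auto simp: annihilator_def r_distr subset_iff)
      then show "a \<in> annihilator R (?I <+>\<^bsub>R\<^esub> ?P)"
        using a by (auto simp: annihilator_def mem_set_add_iff)
    qed
    then have "annihilator R (annihilator R (?I <+>\<^bsub>R\<^esub> ?P)) \<subseteq>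
        annihilator R (annihilator R ?I \<inter> annihilator R ?P)"
      by (rule annihilator_antimono)
    also have "\<dots> \<subseteq> annihilator R (annihilator R ?I) <+>\<^bsub>R\<^esub> annihilator R (annihilator R ?P)"
      using baer hom by (rule annihilator_inter_subset)
    also have "\<dots> \<subseteq> ?I <+>\<^bsub>R\<^esub> ?P"
      using AI AP unfolding subset_iff mem_set_add_iff by blast
    finally show ?case using eq I P homogeneous_ideal_sum by simp
  qed
  then show ?thesis
    unfolding double_annihilator_condition_def finitely_generated_ideal_def
    using double_annihilator_superset by (metis subset_antisym)
qed

end

section \<open>From double annihilators to Baer's criterion\<close>

context graded_commutative_ring
begin

text \<open>Two homomorphisms of the same degree, the given one and right multiplication by \<open>r\<close>, agree on
  a homogeneous ideal. Hence they agree on an ideal as soon as they agree on its generators, and this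
  locus can play the part of the ideal spanned by the generators treated so far.\<close>

lemma homogeneous_ideal_multiplication_locus:
  assumes graph: "graded_graph R G (regular_module R) G d \<Gamma>" and r: "r \<in> G d"
  shows "homogeneous_ideal R G {x. (x, x \<otimes> r) \<in> \<Gamma>}"
proof -
  note \<Gamma> = graded_graphD[OF graph, simplified]
  have rc: "r \<in> carrier R" using r degree_carrier by blast
  show ?thesis
  proof (rule homogeneous_idealI)
    fix x y assume "x \<in> {x. (x, x \<otimes> r) \<in> \<Gamma>}" "y \<in> {x. (x, x \<otimes> r) \<in> \<Gamma>}"
    then have *: "(x, x \<otimes> r) \<in> \<Gamma>" "(y, y \<otimes> r) \<in> \<Gamma>" by auto
    show "x \<oplus> y \<in> {x. (x, x \<otimes> r) \<in> \<Gamma>}"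
      using \<Gamma>(4)[OF *] l_distr[OF \<Gamma>(1)[OF *(1)] \<Gamma>(1)[OF *(2)] rc] by simp
  next
    fix a x assume a: "a \<in> carrier R" and "x \<in> {x. (x, x \<otimes> r) \<in> \<Gamma>}"
    then have *: "(x, x \<otimes> r) \<in> \<Gamma>" by auto
    show "a \<otimes> x \<in> {x. (x, x \<otimes> r) \<in> \<Gamma>}"
      using \<Gamma>(5)[OF a *] m_assoc[OF a \<Gamma>(1)[OF *] rc] by simp
  next
    fix x n assume "x \<in> {x. (x, x \<otimes> r) \<in> \<Gamma>}"
    then have *: "(x, x \<otimes> r) \<in> \<Gamma>" by auto
    show "component R G x n \<in> {x. (x, x \<otimes> r) \<in> \<Gamma>}"
      using \<Gamma>(6)[OF *, of n] component_rmult[OF r \<Gamma>(1)[OF *]] by simp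
  qed (use \<Gamma>(1,3) rc in auto)
qed

text \<open>Multipliers for the single generators exist by the double annihilator condition for principal
  ideals, and they are glued by means of \<open>ann(I \<inter> J) = ann(I) + ann(J)\<close>.\<close>

lemma baer_if_double_annihilator:
  assumes noeth: "graded_noetherian R G" and dac: "double_annihilator_condition R G"
  shows "graded_baer R G"
  unfolding graded_baer_def
proof (intro allI impI)
  fix d \<Gamma> assume graph: "graded_graph R G (regular_module R) G d \<Gamma>"
  note \<Gamma> = graded_graphD[OF graph, simplified]
  have ann2: "annihilator R (annihilator R J) = J" if "homogeneous_ideal R G J" for J
    using noeth dac that unfolding graded_noetherian_def double_annihilator_condition_def by blast
  have inter: "annihilator R (I \<inter> J) \<subseteq> annihilator R I <+>\<^bsub>R\<^esub> annihilator R J"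
    if I: "homogeneous_ideal R G I" and J: "homogeneous_ideal R G J" for I J
  proof -
    let ?K = "annihilator R I <+>\<^bsub>R\<^esub> annihilator R J"
    have AI: "homogeneous_ideal R G (annihilator R I)" and AJ: "homogeneous_ideal R G (annihilator R J)"
      using I J by (auto intro: homogeneous_ideal_annihilator)
    note A = homogeneous_idealD[OF AI] and B = homogeneous_idealD[OF AJ]
    have "a \<in> ?K" if "a \<in> annihilator R I" for a
      using that A(2) B(3) r_zero[of a] unfolding mem_set_add_iff by (metis subsetD)
    moreover have "a \<in> ?K" if "a \<in> annihilator R J" for a
      using that B(2) A(3) l_zero[of a] unfolding mem_set_add_iff by (metis subsetD)
    ultimately have "annihilator R ?K \<subseteq> annihilator R (annihilator R I)"
      "annihilator R ?K \<subseteq> annihilator R (annihilator R J)"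
      by (auto intro!: annihilator_antimono)
    then have "annihilator R ?K \<subseteq> I \<inter> J" using ann2 I J by simp
    then have "annihilator R (I \<inter> J) \<subseteq> annihilator R (annihilator R ?K)"
      by (rule annihilator_antimono)
    then show ?thesis using ann2[OF homogeneous_ideal_sum[OF AI AJ]] by simp
  qed
  have main: "\<exists>r\<in>G d. \<forall>s\<in>S. (s, s \<otimes> r) \<in> \<Gamma>"
    if "finite S" "S \<subseteq> (\<Union>n. G n)" "S \<subseteq> Domain \<Gamma>" for S
    using that
  proof (induction S rule: finite_induct)
    case empty
    show ?case using zero_degree by blast
  next
    case (insert x S)
    then obtain r' where r': "r' \<in> G d" "\<forall>s\<in>S. (s, s \<otimes> r') \<in> \<Gamma>" by auto
    obtain n where x: "x \<in> G n" using insert.prems by blast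
    obtain y where xy: "(x, y) \<in> \<Gamma>" using insert.prems by blast
    have xc: "x \<in> carrier R" and r'c: "r' \<in> carrier R" and yc: "y \<in> carrier R"
      using x r' degree_carrier \<Gamma>(2)[OF xy] by auto
    let ?P = "principal x" and ?E = "{z. (z, z \<otimes> r') \<in> \<Gamma>}"
    have P: "homogeneous_ideal R G ?P" using x by (rule homogeneous_ideal_principal)
    have E: "homogeneous_ideal R G ?E"
      using graph r'(1) by (rule homogeneous_ideal_multiplication_locus)
    have A: "homogeneous_ideal R G (annihilator R ?P)"
      using P by (rule homogeneous_ideal_annihilator)
    \<comment> \<open>The value \<open>y\<close> at \<open>x\<close> is killed by whatever kills \<open>x\<close>, so it is a multiple of \<open>x\<close>.\<close>
    have "a \<otimes> y = \<zero>" if "a \<in> annihilator R ?P" for a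
    proof -
      have a: "a \<in> carrier R" "a \<otimes> x = \<zero>"
        using that mem_annihilator_principal_iff[OF x] by auto
      then have "(\<zero>, a \<otimes> y) \<in> \<Gamma>" using \<Gamma>(5)[OF a(1) xy] by simp
      then show ?thesis by (rule \<Gamma>(7))
    qed
    then have "y \<in> annihilator R (annihilator R ?P)"
      using right_annihilator_iff[OF A] yc by blast
    then obtain t where t: "t \<in> carrier R" "y = t \<otimes> x" using ann2[OF P] by auto
    obtain s where s: "s \<in> carrier R" "y = x \<otimes> s"
      using move_homogeneous_left[OF x t(1)] t(2) by auto
    have "z \<otimes> (r' \<ominus> s) = \<zero>" if z: "z \<in> ?E \<inter> ?P" for z
    proof -
      obtain b where b: "b \<in> carrier R" "z = b \<otimes> x" using z by blast
      have zc: "z \<in> carrier R" using b xc by simp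
      have "(z, z \<otimes> s) \<in> \<Gamma>" using \<Gamma>(5)[OF b(1) xy] b s xc by (simp add: m_assoc)
      moreover have "(z, z \<otimes> r') \<in> \<Gamma>" using z by blast
      ultimately have "z \<otimes> s = z \<otimes> r'"
        using left_module.graded_graph_single_valued[OF left_module_regular graph] by blast
      then show ?thesis using zc r'c s by (simp add: a_minus_def r_distr r_minus r_neg)
    qed
    then have "r' \<ominus> s \<in> annihilator R (?E \<inter> ?P)"
      using right_annihilator_iff[OF homogeneous_ideal_inter[OF E P]] r'c s by simp
    then obtain u v where u: "u \<in> annihilator R ?E" and v: "v \<in> annihilator R ?P"
      and uv: "r' \<ominus> s = u \<oplus> v"
      using inter[OF E P] unfolding subset_iff mem_set_add_iff by blast
    have uc: "u \<in> carrier R" and vc: "v \<in> carrier R" using u v annihilatorD by auto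
    \<comment> \<open>Subtracting \<open>u\<close> does not change \<open>r'\<close> on the old generators; adding \<open>v\<close> does not change \<open>s\<close> on \<open>x\<close>.\<close>
    define r where "r = r' \<ominus> u"
    have rc: "r \<in> carrier R" using r'c uc by (simp add: r_def)
    have r: "r = s \<oplus> v"
    proof -
      have "r' = (r' \<ominus> s) \<oplus> s" using r'c s by (simp add: a_minus_def a_assoc l_neg)
      then have "r = (u \<oplus> v \<oplus> s) \<ominus> u" using uv by (simp add: r_def)
      also have "\<dots> = (s \<oplus> v) \<oplus> (u \<oplus> \<ominus> u)"
        using uc vc s by (simp add: a_minus_def a_ac)
      finally show ?thesis using uc vc s by (simp add: r_neg)
    qed
    have xr: "x \<otimes> r = y"
    proof -
      have "x \<in> ?P" using xc by (metis image_eqI l_one one_closed)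
      then have "x \<otimes> v = \<zero>" using v right_annihilator_iff[OF P] by blast
      then show ?thesis using r xc vc s by (simp add: r_distr)
    qed
    have Sr: "z \<otimes> r = z \<otimes> r'" if z: "z \<in> S" for z
    proof -
      have "z \<in> ?E" using r'(2) z by simp
      then have "z \<otimes> u = \<zero>" using u right_annihilator_iff[OF E] by blast
      moreover have "z \<in> carrier R" using \<open>z \<in> ?E\<close> \<Gamma>(1) by blast
      ultimately show ?thesis using r'c uc by (simp add: r_def a_minus_def r_distr r_minus)
    qed
    \<comment> \<open>On homogeneous generators only the component of \<open>r\<close> in degree \<open>d\<close> contributes.\<close>
    have "(z, z \<otimes> component R G r d) \<in> \<Gamma>" if z: "z \<in> insert x S" for z
    proof -
      have zr: "(z, z \<otimes> r) \<in> \<Gamma>" using z xr xy Sr r'(2) by auto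
      obtain m where m: "z \<in> G m" using z insert.prems(1) by blast
      have "component R G (z \<otimes> r) (m + d) = z \<otimes> component R G r d"
        using component_lmult[OF m rc, of d] by (simp add: add.commute)
      then show ?thesis
        using \<Gamma>(6)[OF zr, of m] component_homogeneous[OF m] by simp
    qed
    then show ?case using component_degree[OF rc] by blast
  qed
  have "finitely_generated_ideal R G (Domain \<Gamma>)"
    using noeth homogeneous_ideal_Domain[OF graph] by (simp add: graded_noetherian_def)
  then obtain S where S: "S \<subseteq> (\<Union>n. G n)" "finite S" "Domain \<Gamma> = Idl S"
    by (auto simp only: finitely_generated_ideal_def)
  have Sc: "S \<subseteq> carrier R" using S(1) degree_carrier by blast
  obtain r where r: "r \<in> G d" "\<forall>s\<in>S. (s, s \<otimes> r) \<in> \<Gamma>"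
    using main[OF S(2,1), unfolded S(3), OF genideal_self[OF Sc]] by (elim bexE)
  have locus: "Idl S \<subseteq> {x. (x, x \<otimes> r) \<in> \<Gamma>}"
    using homogeneous_idealD(1)[OF homogeneous_ideal_multiplication_locus[OF graph r(1)]] r(2)
    by (intro genideal_minimal) auto
  have "y = x \<otimes> r" if xy: "(x, y) \<in> \<Gamma>" for x y
  proof -
    have "x \<in> Idl S" using DomainI[OF xy] unfolding S(3) .
    then have "(x, x \<otimes> r) \<in> \<Gamma>" using locus by blast
    then show ?thesis
      by (rule left_module.graded_graph_single_valued[OF left_module_regular graph xy])
  qed
  then show "\<exists>r\<in>G d. \<forall>(x, y)\<in>\<Gamma>. y = x \<otimes> r" using r(1) by blast
qed

end

section \<open>From Baer's criterion to injectivity\<close>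

lemma graded_module_homD:
  assumes "graded_module_hom R M H N K f"
  shows "\<And>x. x \<in> carrier M \<Longrightarrow> f x \<in> carrier N"
    and "\<And>x y. x \<in> carrier M \<Longrightarrow> y \<in> carrier M \<Longrightarrow> f (x \<oplus>\<^bsub>M\<^esub> y) = f x \<oplus>\<^bsub>N\<^esub> f y"
    and "\<And>a x. a \<in> carrier R \<Longrightarrow> x \<in> carrier M \<Longrightarrow> f (a \<odot>\<^bsub>M\<^esub> x) = a \<odot>\<^bsub>N\<^esub> f x"
    and "\<And>n x. x \<in> H n \<Longrightarrow> f x \<in> K n"
proof -
  show "\<And>n x. x \<in> H n \<Longrightarrow> f x \<in> K n"
    using assms unfolding graded_module_hom_def by blast
qed (use assms in \<open>auto simp: graded_module_hom_def hom_def\<close>)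

lemma graded_module_hom_zero:
  assumes "graded_module R G M H" "graded_module R G N K" "graded_module_hom R M H N K f"
  shows "f \<zero>\<^bsub>M\<^esub> = \<zero>\<^bsub>N\<^esub>"
proof -
  interpret M: graded_module R G M H by fact
  interpret N: graded_module R G N K by fact
  have "f \<zero>\<^bsub>M\<^esub> = \<zero>\<^bsub>R\<^esub> \<odot>\<^bsub>N\<^esub> f \<zero>\<^bsub>M\<^esub>"
    using graded_module_homD(3)[OF assms(3), of "\<zero>\<^bsub>R\<^esub>" "\<zero>\<^bsub>M\<^esub>"] by (simp add: M.smult_l_zero)
  then show ?thesis using graded_module_homD(1)[OF assms(3)] by (simp add: N.smult_l_zero)
qed

lemma component_graded_module_hom:
  assumes "graded_module R G M H" "graded_module R G N K" "graded_module_hom R M H N K f"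
    and "x \<in> carrier M"
  shows "component N K (f x) n = f (component M H x n)"
proof -
  interpret M: graded_module R G M H by fact
  interpret N: graded_module R G N K by fact
  note f = graded_module_homD[OF assms(3)]
  have "component N K (f x) (n + 0) = f (component M H x n)"
    by (rule M.N.component_additive_map[OF N.N.graded_abelian_group_axioms])
      (use assms(4) f in auto)
  then show ?thesis by simp
qed

context graded_commutative_ring
begin

text \<open>A homomorphism to be extended along the monomorphism \<open>i\<close>, viewed as a partial homomorphism
  on the target of \<open>i\<close>.\<close>

lemma graded_graph_of_span:
  assumes M: "graded_module R G M H" and N: "graded_module R G N L"
    and i: "graded_module_hom R M H N L i" "inj_on i (carrier M)"
    and f: "graded_module_hom R M H (regular_module R) G f"
  shows "graded_graph R G N L 0 ((\<lambda>m. (i m, f m)) ` carrier M)"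
proof -
  interpret M: graded_module R G M H by fact
  note I = graded_module_homD[OF i(1)] and F = graded_module_homD[OF f, simplified]
  have i0: "i \<zero>\<^bsub>M\<^esub> = \<zero>\<^bsub>N\<^esub>" using M N i(1) by (rule graded_module_hom_zero)
  have f0: "f \<zero>\<^bsub>M\<^esub> = \<zero>"
    using graded_module_hom_zero[OF M graded_module_regular f] by simp
  show ?thesis
  proof (rule graded_graphI)
    show "(\<zero>\<^bsub>N\<^esub>, \<zero>) \<in> (\<lambda>m. (i m, f m)) ` carrier M"
      by (rule image_eqI[of _ _ "\<zero>\<^bsub>M\<^esub>"]) (simp_all add: i0 f0)
  next
    fix x y x' y' assume "(x, y) \<in> (\<lambda>m. (i m, f m)) ` carrier M" "(x', y') \<in> (\<lambda>m. (i m, f m)) ` carrier M"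
    then obtain m m' where "m \<in> carrier M" "m' \<in> carrier M" "x = i m" "y = f m" "x' = i m'" "y' = f m'"
      by blast
    then show "(x \<oplus>\<^bsub>N\<^esub> x', y \<oplus> y') \<in> (\<lambda>m. (i m, f m)) ` carrier M"
      by (intro image_eqI[of _ _ "m \<oplus>\<^bsub>M\<^esub> m'"]) (simp_all add: I(2) F(2))
  next
    fix a x y assume a: "a \<in> carrier R" and "(x, y) \<in> (\<lambda>m. (i m, f m)) ` carrier M"
    then obtain m where "m \<in> carrier M" "x = i m" "y = f m" by blast
    then show "(a \<odot>\<^bsub>N\<^esub> x, a \<otimes> y) \<in> (\<lambda>m. (i m, f m)) ` carrier M"
      using a by (intro image_eqI[of _ _ "a \<odot>\<^bsub>M\<^esub> m"]) (simp_all add: I(3) F(3) M.smult_closed)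
  next
    fix x y n assume "(x, y) \<in> (\<lambda>m. (i m, f m)) ` carrier M"
    then obtain m where m: "m \<in> carrier M" "x = i m" "y = f m" by blast
    show "(component N L x n, component R G y (n + 0)) \<in> (\<lambda>m. (i m, f m)) ` carrier M"
      using m component_graded_module_hom[OF M N i(1) m(1), of n]
        component_graded_module_hom[OF M graded_module_regular f m(1), of n]
      by (intro image_eqI[of _ _ "component M H m n"]) (simp_all add: M.N.component_closed)
  next
    fix y assume "(\<zero>\<^bsub>N\<^esub>, y) \<in> (\<lambda>m. (i m, f m)) ` carrier M"
    then obtain m where "m \<in> carrier M" "i m = i \<zero>\<^bsub>M\<^esub>" "y = f m" using i0 by auto
    then show "y = \<zero>" using inj_onD[OF i(2)] f0 M.M.zero_closed by metis
  qed (use I(1) F(1) in auto)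
qed

text \<open>The scalars \<open>a\<close> with \<open>a \<odot> x\<close> in the domain form a homogeneous ideal, on which \<open>a \<mapsto> \<Gamma>(a \<odot> x)\<close> has the
  degree of \<open>x\<close>. Baer's criterion represents this map by some \<open>r\<close>, a consistent value at \<open>x\<close>.\<close>

lemma graded_graph_extend:
  assumes baer: "graded_baer R G" and N: "graded_module R G N L"
    and graph: "graded_graph R G N L 0 \<Gamma>" and x: "x \<in> L e"
  shows "\<exists>\<Gamma>'. graded_graph R G N L 0 \<Gamma>' \<and> \<Gamma> \<subseteq> \<Gamma>' \<and> x \<in> Domain \<Gamma>'"
proof -
  interpret N: graded_module R G N L by fact
  note \<Gamma> = graded_graphD[OF graph]
  have xc: "x \<in> carrier N" using x by (rule N.N.degree_carrier)
  let ?\<Delta> = "{(a, y). a \<in> carrier R \<and> (a \<odot>\<^bsub>N\<^esub> x, y) \<in> \<Gamma>}"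
  have "graded_graph R G (regular_module R) G e ?\<Delta>"
  proof (rule graded_graphI, simp_all only: regular_module_simps component_regular_module)
    show "(\<zero>, \<zero>) \<in> ?\<Delta>" using \<Gamma>(3) xc by (simp add: N.smult_l_zero)
  next
    fix a y a' y' assume *: "(a, y) \<in> ?\<Delta>" "(a', y') \<in> ?\<Delta>"
    then show "(a \<oplus> a', y \<oplus> y') \<in> ?\<Delta>"
      using \<Gamma>(4)[of "a \<odot>\<^bsub>N\<^esub> x" y "a' \<odot>\<^bsub>N\<^esub> x" y'] xc by (simp add: N.smult_l_distr)
  next
    fix b a y assume "b \<in> carrier R" "(a, y) \<in> ?\<Delta>"
    then show "(b \<otimes> a, b \<otimes> y) \<in> ?\<Delta>"
      using \<Gamma>(5)[of b "a \<odot>\<^bsub>N\<^esub> x" y] xc by (simp add: N.smult_assoc)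
  next
    fix a y n assume "(a, y) \<in> ?\<Delta>"
    then show "(component R G a n, component R G y (n + e)) \<in> ?\<Delta>"
      using \<Gamma>(6)[of "a \<odot>\<^bsub>N\<^esub> x" y "n + e"] N.component_smult_element[OF x, of a n] component_closed
      by simp
  next
    fix y assume "(\<zero>, y) \<in> ?\<Delta>"
    then show "y = \<zero>" using \<Gamma>(7) xc by (simp add: N.smult_l_zero)
  qed (use \<Gamma>(2) in auto)
  then obtain r where r: "r \<in> G e" "\<forall>(a, y)\<in>?\<Delta>. y = a \<otimes> r"
    using baer unfolding graded_baer_def by blast
  have rc: "r \<in> carrier R" using r(1) by (rule degree_carrier)
  have val: "y = a \<otimes> r" if "a \<in> carrier R" "(a \<odot>\<^bsub>N\<^esub> x, y) \<in> \<Gamma>" for a y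
    using r(2) that by blast
  let ?\<Gamma>' = "{(p \<oplus>\<^bsub>N\<^esub> a \<odot>\<^bsub>N\<^esub> x, q \<oplus> a \<otimes> r) | p q a. (p, q) \<in> \<Gamma> \<and> a \<in> carrier R}"
  have mem: "(u, v) \<in> ?\<Gamma>'"
    if "(p, q) \<in> \<Gamma>" "a \<in> carrier R" "u = p \<oplus>\<^bsub>N\<^esub> a \<odot>\<^bsub>N\<^esub> x" "v = q \<oplus> a \<otimes> r" for p q a u v
    using that by blast
  have memE: "\<exists>p q a. (p, q) \<in> \<Gamma> \<and> a \<in> carrier R \<and> p \<in> carrier N \<and> q \<in> carrier R \<and>
      a \<odot>\<^bsub>N\<^esub> x \<in> carrier N \<and> a \<otimes> r \<in> carrier R \<and> u = p \<oplus>\<^bsub>N\<^esub> a \<odot>\<^bsub>N\<^esub> x \<and> v = q \<oplus> a \<otimes> r"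
    if "(u, v) \<in> ?\<Gamma>'" for u v
  proof -
    obtain p q a where *: "(p, q) \<in> \<Gamma>" "a \<in> carrier R" "u = p \<oplus>\<^bsub>N\<^esub> a \<odot>\<^bsub>N\<^esub> x" "v = q \<oplus> a \<otimes> r"
      using \<open>(u, v) \<in> ?\<Gamma>'\<close> by blast
    then show ?thesis
      using \<Gamma>(1,2)[OF *(1)] N.smult_closed[OF *(2) xc] m_closed[OF *(2) rc] by blast
  qed
  have "graded_graph R G N L 0 ?\<Gamma>'"
  proof (rule graded_graphI)
    show "u \<in> carrier N" "v \<in> carrier R" if "(u, v) \<in> ?\<Gamma>'" for u v
      using memE[OF that] by auto
    show "(\<zero>\<^bsub>N\<^esub>, \<zero>) \<in> ?\<Gamma>'"
      by (rule mem[OF \<Gamma>(3) zero_closed]) (use xc rc in \<open>simp_all add: N.smult_l_zero\<close>)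
  next
    fix u v u' v' assume "(u, v) \<in> ?\<Gamma>'" "(u', v') \<in> ?\<Gamma>'"
    from memE[OF this(1)] memE[OF this(2)] obtain p q a p' q' a' where
      1: "(p, q) \<in> \<Gamma>" "a \<in> carrier R" "p \<in> carrier N" "q \<in> carrier R" "a \<odot>\<^bsub>N\<^esub> x \<in> carrier N"
        "a \<otimes> r \<in> carrier R" "u = p \<oplus>\<^bsub>N\<^esub> a \<odot>\<^bsub>N\<^esub> x" "v = q \<oplus> a \<otimes> r" and
      2: "(p', q') \<in> \<Gamma>" "a' \<in> carrier R" "p' \<in> carrier N" "q' \<in> carrier R" "a' \<odot>\<^bsub>N\<^esub> x \<in> carrier N"
        "a' \<otimes> r \<in> carrier R" "u' = p' \<oplus>\<^bsub>N\<^esub> a' \<odot>\<^bsub>N\<^esub> x" "v' = q' \<oplus> a' \<otimes> r"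
      by blast
    show "(u \<oplus>\<^bsub>N\<^esub> u', v \<oplus> v') \<in> ?\<Gamma>'"
    proof (rule mem[OF \<Gamma>(4)[OF 1(1) 2(1)] a_closed[OF 1(2) 2(2)]])
      show "u \<oplus>\<^bsub>N\<^esub> u' = p \<oplus>\<^bsub>N\<^esub> p' \<oplus>\<^bsub>N\<^esub> (a \<oplus> a') \<odot>\<^bsub>N\<^esub> x"
        using 1 2 by (simp add: N.smult_l_distr xc N.M.a_ac)
      show "v \<oplus> v' = q \<oplus> q' \<oplus> (a \<oplus> a') \<otimes> r"
        using 1 2 by (simp add: l_distr rc a_ac)
    qed
  next
    fix b u v assume b: "b \<in> carrier R" and "(u, v) \<in> ?\<Gamma>'"
    from memE[OF this(2)] obtain p q a where
      1: "(p, q) \<in> \<Gamma>" "a \<in> carrier R" "p \<in> carrier N" "q \<in> carrier R" "a \<odot>\<^bsub>N\<^esub> x \<in> carrier N"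
        "a \<otimes> r \<in> carrier R" "u = p \<oplus>\<^bsub>N\<^esub> a \<odot>\<^bsub>N\<^esub> x" "v = q \<oplus> a \<otimes> r"
      by blast
    show "(b \<odot>\<^bsub>N\<^esub> u, b \<otimes> v) \<in> ?\<Gamma>'"
    proof (rule mem[OF \<Gamma>(5)[OF b 1(1)] m_closed[OF b 1(2)]])
      show "b \<odot>\<^bsub>N\<^esub> u = b \<odot>\<^bsub>N\<^esub> p \<oplus>\<^bsub>N\<^esub> (b \<otimes> a) \<odot>\<^bsub>N\<^esub> x"
        using 1 b xc by (simp add: N.smult_r_distr N.smult_assoc)
      show "b \<otimes> v = b \<otimes> q \<oplus> b \<otimes> a \<otimes> r"
        using 1 b rc by (simp add: r_distr m_assoc)
    qed
  next
    fix u v n assume "(u, v) \<in> ?\<Gamma>'"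
    from memE[OF this] obtain p q a where
      1: "(p, q) \<in> \<Gamma>" "a \<in> carrier R" "p \<in> carrier N" "q \<in> carrier R" "a \<odot>\<^bsub>N\<^esub> x \<in> carrier N"
        "a \<otimes> r \<in> carrier R" "u = p \<oplus>\<^bsub>N\<^esub> a \<odot>\<^bsub>N\<^esub> x" "v = q \<oplus> a \<otimes> r"
      by blast
    show "(component N L u n, component R G v (n + 0)) \<in> ?\<Gamma>'"
    proof (rule mem[OF \<Gamma>(6)[OF 1(1), of n] component_closed[OF 1(2), of "n - e"]])
      show "component N L u n = component N L p n \<oplus>\<^bsub>N\<^esub> component R G a (n - e) \<odot>\<^bsub>N\<^esub> x"
        using N.component_smult_element[OF x 1(2), of "n - e"] N.N.component_add[OF 1(3,5)] 1(7)
        by simp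
      show "component R G v (n + 0) = component R G q (n + 0) \<oplus> component R G a (n - e) \<otimes> r"
        using component_rmult[OF r(1) 1(2), of "n - e"] component_add[OF 1(4,6)] 1(8) by simp
    qed
  next
    fix v assume "(\<zero>\<^bsub>N\<^esub>, v) \<in> ?\<Gamma>'"
    from memE[OF this] obtain p q a where
      1: "(p, q) \<in> \<Gamma>" "a \<in> carrier R" "p \<in> carrier N" "q \<in> carrier R" "a \<odot>\<^bsub>N\<^esub> x \<in> carrier N"
        "a \<otimes> r \<in> carrier R" "\<zero>\<^bsub>N\<^esub> = p \<oplus>\<^bsub>N\<^esub> a \<odot>\<^bsub>N\<^esub> x" "v = q \<oplus> a \<otimes> r"
      by blast
    \<comment> \<open>Here \<open>p\<close> is a multiple of \<open>x\<close> in the old domain, where the value is already given by \<open>r\<close>.\<close>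
    have "p = (\<ominus> a) \<odot>\<^bsub>N\<^esub> x"
      using N.M.minus_equality[OF 1(7)[symmetric] 1(5,3)] N.smult_l_minus[OF 1(2) xc] by simp
    then have "q = (\<ominus> a) \<otimes> r" using val[of "\<ominus> a" q] 1(1,2) by simp
    then show "v = \<zero>" using 1 rc by (simp add: l_minus l_neg)
  qed
  moreover have "\<Gamma> \<subseteq> ?\<Gamma>'"
  proof (rule subrelI)
    fix p q assume pq: "(p, q) \<in> \<Gamma>"
    show "(p, q) \<in> ?\<Gamma>'"
      by (rule mem[OF pq zero_closed]) (use \<Gamma>(1,2)[OF pq] xc rc in \<open>simp_all add: N.smult_l_zero\<close>)
  qed
  moreover have "(x, r) \<in> ?\<Gamma>'"
    by (rule mem[OF \<Gamma>(3) one_closed]) (use xc rc in \<open>simp_all add: N.smult_one\<close>)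
  ultimately show ?thesis by blast
qed

lemma graded_graph_Union:
  assumes chain: "subset.chain {\<Gamma>. graded_graph R G N L d \<Gamma>} C" and ne: "C \<noteq> {}"
  shows "graded_graph R G N L d (\<Union>C)"
proof -
  have graph: "graded_graph R G N L d \<Gamma>" if "\<Gamma> \<in> C" for \<Gamma>
    using chain that by (auto simp: subset_chain_def)
  have le: "\<Gamma> \<subseteq> \<Gamma>' \<or> \<Gamma>' \<subseteq> \<Gamma>" if "\<Gamma> \<in> C" "\<Gamma>' \<in> C" for \<Gamma> \<Gamma>'
    using chain that by (auto simp: subset_chain_def)
  show ?thesis
  proof (rule graded_graphI)
    fix x y x' y' assume "(x, y) \<in> \<Union>C" "(x', y') \<in> \<Union>C"
    then obtain \<Gamma> \<Gamma>' where "\<Gamma> \<in> C" "(x, y) \<in> \<Gamma>" "\<Gamma>' \<in> C" "(x', y') \<in> \<Gamma>'" by blast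
    then obtain \<Delta> where \<Delta>: "\<Delta> \<in> C" "(x, y) \<in> \<Delta>" "(x', y') \<in> \<Delta>" using le[of \<Gamma> \<Gamma>'] by blast
    show "(x \<oplus>\<^bsub>N\<^esub> x', y \<oplus> y') \<in> \<Union>C"
      using graded_graphD(4)[OF graph[OF \<Delta>(1)] \<Delta>(2,3)] \<Delta>(1) by blast
  next
    show "(\<zero>\<^bsub>N\<^esub>, \<zero>) \<in> \<Union>C" using ne graded_graphD(3)[OF graph] by blast
  next
    fix a x y assume a: "a \<in> carrier R" and "(x, y) \<in> \<Union>C"
    then obtain \<Gamma> where \<Gamma>: "\<Gamma> \<in> C" "(x, y) \<in> \<Gamma>" by blast
    show "(a \<odot>\<^bsub>N\<^esub> x, a \<otimes> y) \<in> \<Union>C"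
      using graded_graphD(5)[OF graph[OF \<Gamma>(1)] a \<Gamma>(2)] \<Gamma>(1) by blast
  next
    fix x y n assume "(x, y) \<in> \<Union>C"
    then obtain \<Gamma> where \<Gamma>: "\<Gamma> \<in> C" "(x, y) \<in> \<Gamma>" by blast
    show "(component N L x n, component R G y (n + d)) \<in> \<Union>C"
      using graded_graphD(6)[OF graph[OF \<Gamma>(1)] \<Gamma>(2)] \<Gamma>(1) by blast
  qed (auto dest: graded_graphD(1,2,7)[OF graph])
qed

text \<open>A maximal graph above the given homomorphism contains every homogeneous element in its domain,
  hence all of \<open>N\<close>.\<close>

lemma self_injective_if_baer:
  assumes baer: "graded_baer R G"
  shows "graded_self_injective TYPE('m) R G"
  unfolding graded_self_injective_def graded_injective_def
proof (intro conjI allI impI)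
  show "graded_module R G (regular_module R) G" by (rule graded_module_regular)
next
  fix M :: "('a, 'm) module" and H and N :: "('a, 'm) module" and L i f
  assume M: "graded_module R G M H" and N: "graded_module R G N L"
    and i: "graded_module_hom R M H N L i" "inj_on i (carrier M)"
    and f: "graded_module_hom R M H (regular_module R) G f"
  interpret N: graded_module R G N L by fact
  let ?\<Gamma>0 = "(\<lambda>m. (i m, f m)) ` carrier M"
  let ?A = "{\<Gamma>. graded_graph R G N L 0 \<Gamma> \<and> ?\<Gamma>0 \<subseteq> \<Gamma>}"
  have "\<exists>\<Gamma>\<in>?A. \<forall>\<Gamma>'\<in>?A. \<Gamma> \<subseteq> \<Gamma>' \<longrightarrow> \<Gamma>' = \<Gamma>"
  proof (rule subset_Zorn_nonempty)
    show "?A \<noteq> {}" using graded_graph_of_span[OF M N i f] by blast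
    fix C assume C: "C \<noteq> {}" "subset.chain ?A C"
    then have "subset.chain {\<Gamma>. graded_graph R G N L 0 \<Gamma>} C" "\<forall>\<Gamma>\<in>C. ?\<Gamma>0 \<subseteq> \<Gamma>"
      by (auto simp: subset_chain_def)
    then show "\<Union>C \<in> ?A" using graded_graph_Union C(1) by blast
  qed
  then obtain \<Gamma> where mem: "\<Gamma> \<in> ?A" and maximal: "\<forall>\<Gamma>'\<in>?A. \<Gamma> \<subseteq> \<Gamma>' \<longrightarrow> \<Gamma>' = \<Gamma>"
    by (elim bexE)
  have graph: "graded_graph R G N L 0 \<Gamma>" and sub: "?\<Gamma>0 \<subseteq> \<Gamma>"
    using mem by simp_all
  have max: "\<Gamma>' = \<Gamma>" if "graded_graph R G N L 0 \<Gamma>'" "\<Gamma> \<subseteq> \<Gamma>'" for \<Gamma>'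
  proof -
    have "\<Gamma>' \<in> ?A" using that(1) order_trans[OF sub that(2)] by (intro CollectI conjI)
    then show ?thesis using bspec[OF maximal, of \<Gamma>'] that(2) by simp
  qed
  note \<Gamma> = graded_graphD[OF graph]
  have homog: "x \<in> Domain \<Gamma>" if "x \<in> L e" for x e
  proof -
    obtain \<Gamma>' where ext: "graded_graph R G N L 0 \<Gamma>'" "\<Gamma> \<subseteq> \<Gamma>'" and "x \<in> Domain \<Gamma>'"
      using graded_graph_extend[OF baer N graph \<open>x \<in> L e\<close>] by (elim exE conjE)
    then show ?thesis using max[OF ext] by simp
  qed
  have total: "x \<in> Domain \<Gamma>" if x: "x \<in> carrier N" for x
  proof (rule N.N.mem_if_components_mem[OF x])
    show "component N L x n \<in> Domain \<Gamma>" for n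
      using homog N.N.component_degree[OF x] .
  qed (use \<Gamma>(3,4) in blast)+
  define g where "g x = (THE y. (x, y) \<in> \<Gamma>)" for x
  have g: "g x = y" if "(x, y) \<in> \<Gamma>" for x y
    unfolding g_def
  proof (rule the_equality)
    show "(x, y) \<in> \<Gamma>" by fact
    show "z = y" if "(x, z) \<in> \<Gamma>" for z
      using that \<open>(x, y) \<in> \<Gamma>\<close> by (rule N.graded_graph_single_valued[OF graph])
  qed
  have gD: "(x, g x) \<in> \<Gamma>" if x: "x \<in> carrier N" for x
  proof -
    obtain y where "(x, y) \<in> \<Gamma>" using total[OF x] by blast
    then show ?thesis using g[of x y] by simp
  qed
  have "graded_module_hom R N L (regular_module R) G g"
    unfolding graded_module_hom_def
  proof (intro conjI ballI allI)
    show "g \<in> hom (add_monoid N) (add_monoid (regular_module R))"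
      using \<Gamma>(2)[OF gD] g[OF \<Gamma>(4)[OF gD gD]] by (simp add: hom_def)
    show "g (a \<odot>\<^bsub>N\<^esub> x) = a \<odot>\<^bsub>regular_module R\<^esub> g x" if "a \<in> carrier R" "x \<in> carrier N" for a x
      using that g[OF \<Gamma>(5)[OF _ gD]] by simp
    fix n
    show "g ` L n \<subseteq> G n"
    proof clarify
      fix x assume x: "x \<in> L n"
      have xy: "(x, g x) \<in> \<Gamma>" using gD N.N.degree_carrier[OF x] .
      then have "(x, component R G (g x) n) \<in> \<Gamma>"
        using \<Gamma>(6)[OF xy, of n] N.N.component_homogeneous[OF x] by simp
      then have "g x = component R G (g x) n" by (rule g)
      then show "g x \<in> G n" using component_degree[OF \<Gamma>(2)[OF xy], of n] by simp
    qed
  qed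
  moreover have "\<forall>x\<in>carrier M. g (i x) = f x" using sub by (auto intro!: g)
  ultimately show "\<exists>g. graded_module_hom R N L (regular_module R) G g \<and> (\<forall>x\<in>carrier M. g (i x) = f x)"
    by blast
qed

end

theorem proposition1p15:
  fixes R :: "('a, 'c) ring_scheme" and G :: "int \<Rightarrow> 'a set"
  assumes "graded_commutative_ring R G"
  shows "(graded_self_injective TYPE('a) R G \<longrightarrow> double_annihilator_condition R G) \<and>
         (graded_noetherian R G \<and> double_annihilator_condition R G
            \<longrightarrow> graded_self_injective TYPE('m) R G)"
proof -
  interpret graded_commutative_ring R G by fact
  show ?thesis
    using graded_baer_if_self_injective double_annihilator_if_baer baer_if_double_annihilator
      self_injective_if_baer by blast
qed

end
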